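(* Let $X$ be a countably based $T_0$-space. The following are equivalent: (1) $X$ is completely Baire; (2) $X$ does not contain a non-empty $\mathbf{\Pi}^0_2$-subset which (with the subspace topology) is a countable perfect $T_D$-space; (3) $X$ does not contain a $\mathbf{\Pi}^0_2$-subset homeomorphic to $S_D$, $S_1$, or $S_2$; (4) every $\mathbf{\Pi}^0_2$-subspace of $X$ is a Baire space; (5) every $\mathbf{\Pi}^0_2$-subspace of $X$ is a completely Baire space.
   Context: Countably based means second countable. For a topological space $X$, $\mathbf{\Sigma}^0_2(X)$ is the set of all subsets of the form $\bigcup_{i\in\omega}U_i\setminus V_i$ with $U_i,V_i\subseteq X$ open, and $\mathbf{\Pi}^0_2(X)$ is the set of complements of members of $\mathbf{\Sigma}^0_2(X)$; a $\mathbf{\Pi}^0_2$-subset (or $\mathbf{\Pi}^0_2$-subspace) of $X$ is a member of $\mathbf{\Pi}^0_2(X)$ (with the subspace topology). A space is a Baire space if every intersection of countably many dense open subsets is dense. A space is completely Baire if every closed subspace of it is a Baire space. A subset is locally closed if it is the intersection of an open set with a closed set. A $T_D$-space is a space in which every singleton subset is locally closed. A space is perfect if every non-empty open subset is infinite. $S_2$ is the set of rational numbers with the subspace topology from the reals; $S_1$ is the set of natural numbers with the cofinite topology; $S_D$ is the set of natural numbers with the topology whose non-empty open sets are exactly the sets $\{m\in\omega : n\leq m\}$, $n\in\omega$. *)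

theory Defs
  imports "HOL-Analysis.Analysis"
begin

definition sigma02_in :: "'a topology \<Rightarrow> 'a set \<Rightarrow> bool" where
  "sigma02_in X A \<longleftrightarrow>
     (\<exists>U V :: nat \<Rightarrow> 'a set. (\<forall>i. openin X (U i) \<and> openin X (V i)) \<and> A = (\<Union>i. U i - V i))"

text \<open>For spaces that are not metrizable this class is in general larger than that of the
  \<open>gdelta_in\<close> sets: it contains, for example, every closed set.\<close>

definition pi02_in :: "'a topology \<Rightarrow> 'a set \<Rightarrow> bool" where
  "pi02_in X A \<longleftrightarrow> (\<exists>B. sigma02_in X B \<and> A = topspace X - B)"

definition dense_in :: "'a topology \<Rightarrow> 'a set \<Rightarrow> bool" where
  "dense_in X S \<longleftrightarrow> S \<subseteq> topspace X \<and> X closure_of S = topspace X"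

text \<open>Intersecting with \<open>topspace X\<close> only matters for the empty family, whose intersection is
  otherwise the whole type.\<close>

definition Baire_space :: "'a topology \<Rightarrow> bool" where
  "Baire_space X \<longleftrightarrow>
     (\<forall>\<U>. countable \<U> \<and> (\<forall>U\<in>\<U>. openin X U \<and> dense_in X U)
          \<longrightarrow> dense_in X (topspace X \<inter> \<Inter>\<U>))"

definition completely_Baire_space :: "'a topology \<Rightarrow> bool" where
  "completely_Baire_space X \<longleftrightarrow> (\<forall>C. closedin X C \<longrightarrow> Baire_space (subtopology X C))"

definition locally_closed_in :: "'a topology \<Rightarrow> 'a set \<Rightarrow> bool" where
  "locally_closed_in X S \<longleftrightarrow> (\<exists>U C. openin X U \<and> closedin X C \<and> S = U \<inter> C)"

definition TD_space :: "'a topology \<Rightarrow> bool" where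
  "TD_space X \<longleftrightarrow> (\<forall>x\<in>topspace X. locally_closed_in X {x})"

definition perfect_space :: "'a topology \<Rightarrow> bool" where
  "perfect_space X \<longleftrightarrow> (\<forall>U. openin X U \<and> U \<noteq> {} \<longrightarrow> infinite U)"

definition S\<^sub>2 :: "real topology" where
  "S\<^sub>2 = subtopology euclideanreal \<rat>"

definition S\<^sub>1 :: "nat topology" where
  "S\<^sub>1 = topology (\<lambda>U. U = {} \<or> finite (- U))"

definition S\<^sub>D :: "nat topology" where
  "S\<^sub>D = topology (\<lambda>U. U = {} \<or> (\<exists>n. U = {m. n \<le> m}))"

text \<open>The two predicates above are topologies, so the abstraction function \<open>topology\<close> returns
  the intended spaces.\<close>

lemma openin_S\<^sub>1: "openin S\<^sub>1 U \<longleftrightarrow> U = {} \<or> finite (- U)"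
proof -
  have "istopology (\<lambda>U::nat set. U = {} \<or> finite (- U))"
    unfolding istopology_def
  proof (intro conjI allI impI)
    fix S T :: "nat set"
    assume "S = {} \<or> finite (- S)" "T = {} \<or> finite (- T)"
    then show "S \<inter> T = {} \<or> finite (- (S \<inter> T))" by auto
  next
    fix \<K> :: "nat set set"
    assume *: "\<forall>K\<in>\<K>. K = {} \<or> finite (- K)"
    show "\<Union>\<K> = {} \<or> finite (- \<Union>\<K>)"
    proof (cases "\<exists>K\<in>\<K>. K \<noteq> {}")
      case True
      then obtain K where "K \<in> \<K>" "finite (- K)" using * by blast
      moreover have "- \<Union>\<K> \<subseteq> - K" using \<open>K \<in> \<K>\<close> by blast
      ultimately show ?thesis using finite_subset by blast
    qed auto
  qed
  then show ?thesis by (simp add: S\<^sub>1_def topology_inverse')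
qed

lemma openin_S\<^sub>D: "openin S\<^sub>D U \<longleftrightarrow> U = {} \<or> (\<exists>n. U = {m. n \<le> m})"
proof -
  have "istopology (\<lambda>U::nat set. U = {} \<or> (\<exists>n. U = {m. n \<le> m}))"
    unfolding istopology_def
  proof (intro conjI allI impI)
    fix S T :: "nat set"
    assume ST: "S = {} \<or> (\<exists>n. S = {m. n \<le> m})" "T = {} \<or> (\<exists>n. T = {m. n \<le> m})"
    show "S \<inter> T = {} \<or> (\<exists>n. S \<inter> T = {m. n \<le> m})"
    proof (cases "S = {} \<or> T = {}")
      case False
      then obtain a b where "S = {m. a \<le> m}" "T = {m. b \<le> m}" using ST by auto
      then have "S \<inter> T = {m. max a b \<le> m}" by auto
      then show ?thesis by (intro disjI2 exI)
    qed auto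
  next
    fix \<K> :: "nat set set"
    assume *: "\<forall>K\<in>\<K>. K = {} \<or> (\<exists>n. K = {m. n \<le> m})"
    show "\<Union>\<K> = {} \<or> (\<exists>n. \<Union>\<K> = {m. n \<le> m})"
    proof (cases "\<Union>\<K> = {}")
      case False
      define n where "n = (LEAST k. k \<in> \<Union>\<K>)"
      have n: "n \<in> \<Union>\<K>" unfolding n_def by (rule LeastI_ex) (use False in \<open>simp only: ex_in_conv not_False_eq_True\<close>)
      have le: "n \<le> m" if "m \<in> \<Union>\<K>" for m
        unfolding n_def using that by (rule Least_le)
      have ge: "m \<in> \<Union>\<K>" if "n \<le> m" for m
      proof -
        obtain K where K: "K \<in> \<K>" "n \<in> K" using n by blast
        then obtain k where "K = {m. k \<le> m}" using * by blast
        then have "m \<in> K" using K(2) that by simp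
        then show ?thesis using K(1) by blast
      qed
      have "\<Union>\<K> = {m. n \<le> m}"
      proof (rule set_eqI)
        fix m
        show "m \<in> \<Union>\<K> \<longleftrightarrow> m \<in> {m. n \<le> m}"
          unfolding mem_Collect_eq using le ge by (rule iffI)
      qed
      then show ?thesis by (intro disjI2 exI)
    qed auto
  qed
  then show ?thesis by (simp add: S\<^sub>D_def topology_inverse')
qed

lemma topspace_S\<^sub>1 [simp]: "topspace S\<^sub>1 = UNIV"
  using openin_subset[of "S\<^sub>1" UNIV] by (auto simp: openin_S\<^sub>1)

lemma topspace_S\<^sub>D [simp]: "topspace S\<^sub>D = UNIV"
proof -
  have "openin S\<^sub>D UNIV" unfolding openin_S\<^sub>D by (intro disjI2 exI[of _ 0]) auto
  then show ?thesis using openin_subset by blast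
qed

end

theory Submission
  imports Defs "HOL-Library.Ramsey"
begin

text \<open>A \<open>\<Pi>\<close>02-subset is comeagre in its closure, which gives the equivalence of (1), (4) and (5); and a
  non-empty countable perfect \<open>T\<^sub>D\<close>-space is meagre in itself, so (4) implies (2), which implies (3).

  For (3) to (1), a space that is not completely Baire has a non-empty locally closed subspace with dense
  open sets \<open>E 0 \<supseteq> E 1 \<supseteq> \<dots>\<close> whose intersection is empty. Call a point branching if arbitrarily close to it there
  are non-empty open sets that are disjoint from one of its neighbourhoods. If the branching points are dense
  in some non-empty open set, one builds a tree of points \<open>x s \<in> U s\<close> whose children converge to \<open>x s\<close> and
  stay separated from it; the rationals carry such a tree as well, and any two of them are homeomorphic.
  Otherwise some non-empty open set consists of points all of whose neighbourhoods are locally dense, and one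
  builds a sequence that converges to each of its members; Ramsey's theorem for the specialization order
  extracts a copy of \<open>S_D\<close> or \<open>S_1\<close>. Requiring \<open>U s \<subseteq> E (length s)\<close>, or \<open>U n \<subseteq> E n\<close>, leaves no points in
  infinitely many of these sets, and this is what makes the set of chosen points \<open>\<Pi>\<close>02.\<close>

section \<open>The second level of the Borel hierarchy\<close>

lemma sigma02_inI:
  assumes "\<And>i::nat. openin X (U i)" "\<And>i. openin X (V i)"
  shows "sigma02_in X (\<Union>i. U i - V i)"
  unfolding sigma02_in_def
  by (rule exI[of _ U], rule exI[of _ V]) (simp only: assms simp_thms)

lemma sigma02_in_diff:
  assumes "openin X U" "openin X V"
  shows "sigma02_in X (U - V)"
proof -
  have "sigma02_in X (\<Union>i::nat. U - V)"
    using assms by (intro sigma02_inI)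
  then show ?thesis by simp
qed

lemma sigma02_inE:
  assumes "sigma02_in X A"
  obtains U V :: "nat \<Rightarrow> 'a set"
  where "\<forall>i. openin X (U i)" "\<forall>i. openin X (V i)" "A = (\<Union>i. U i - V i)"
proof -
  obtain U V :: "nat \<Rightarrow> 'a set"
    where "(\<forall>i. openin X (U i) \<and> openin X (V i)) \<and> A = (\<Union>i. U i - V i)"
    using assms unfolding sigma02_in_def by (elim exE)
  then show thesis by (intro that[of U V]) simp_all
qed

lemma sigma02_in_UN:
  fixes A :: "'i::countable \<Rightarrow> 'a set"
  assumes "\<And>i. sigma02_in X (A i)"
  shows "sigma02_in X (\<Union>i. A i)"
proof -
  have "\<forall>i. \<exists>P :: (nat \<Rightarrow> 'a set) \<times> (nat \<Rightarrow> 'a set).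
      (\<forall>j. openin X (fst P j) \<and> openin X (snd P j)) \<and> A i = (\<Union>j. fst P j - snd P j)"
  proof
    fix i
    obtain U V where "\<forall>j. openin X (U j)" "\<forall>j. openin X (V j)" "A i = (\<Union>j::nat. U j - V j)"
      by (rule sigma02_inE[OF assms[of i]])
    then show "\<exists>P. (\<forall>j. openin X (fst P j) \<and> openin X (snd P j)) \<and> A i = (\<Union>j::nat. fst P j - snd P j)"
      by (intro exI[of _ "(U, V)"]) simp
  qed
  from choice[OF this] obtain P where P: "\<forall>i. (\<forall>j. openin X (fst (P i) j) \<and> openin X (snd (P i) j))
      \<and> A i = (\<Union>j::nat. fst (P i) j - snd (P i) j)" ..
  define U V where "U = (\<lambda>i. fst (P i))" and "V = (\<lambda>i. snd (P i))"
  have UV: "openin X (U i j)" "openin X (V i j)" "A i = (\<Union>j. U i j - V i j)" for i j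
    unfolding U_def V_def using P by simp_all
  let ?f = "\<lambda>n. from_nat n :: 'i \<times> nat"
  have "(\<Union>i. A i) = (\<Union>n. U (fst (?f n)) (snd (?f n)) - V (fst (?f n)) (snd (?f n)))"
  proof (intro equalityI subsetI)
    fix x assume "x \<in> (\<Union>i. A i)"
    then obtain i j where "x \<in> U i j - V i j" unfolding UV(3) by blast
    then have "x \<in> U (fst (?f (to_nat (i, j)))) (snd (?f (to_nat (i, j))))
        - V (fst (?f (to_nat (i, j)))) (snd (?f (to_nat (i, j))))" by simp
    then show "x \<in> (\<Union>n. U (fst (?f n)) (snd (?f n)) - V (fst (?f n)) (snd (?f n)))" by blast
  qed (unfold UV(3), blast)
  moreover have "sigma02_in X \<dots>"
    using UV(1,2) by (intro sigma02_inI)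
  ultimately show ?thesis by (simp only:)
qed

lemma sigma02_in_Un:
  assumes "sigma02_in X A" "sigma02_in X B"
  shows "sigma02_in X (A \<union> B)"
proof -
  have "A \<union> B = (\<Union>b. if b then A else B)" by (auto split: if_splits)
  moreover have "sigma02_in X (\<Union>b. if b then A else B)"
    using assms by (intro sigma02_in_UN) auto
  ultimately show ?thesis by simp
qed

lemma sigma02_in_Int:
  assumes "sigma02_in X A" "sigma02_in X B"
  shows "sigma02_in X (A \<inter> B)"
proof -
  obtain U V where A: "\<forall>i. openin X (U i)" "\<forall>i. openin X (V i)" "A = (\<Union>i::nat. U i - V i)"
    by (rule sigma02_inE[OF assms(1)])
  obtain U' V' where B: "\<forall>i. openin X (U' i)" "\<forall>i. openin X (V' i)" "B = (\<Union>i::nat. U' i - V' i)"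
    by (rule sigma02_inE[OF assms(2)])
  have "A \<inter> B = (\<Union>i. \<Union>j. (U i \<inter> U' j) - (V i \<union> V' j))"
    unfolding A B by blast
  moreover have "sigma02_in X (\<Union>i. \<Union>j. (U i \<inter> U' j) - (V i \<union> V' j))"
    using A B by (intro sigma02_in_UN sigma02_in_diff openin_Int openin_Un) simp_all
  ultimately show ?thesis by (simp only:)
qed

lemma sigma02_in_subset: "sigma02_in X A \<Longrightarrow> A \<subseteq> topspace X"
  unfolding sigma02_in_def by (auto dest: openin_subset)

text \<open>Sets satisfying \<open>sigma02_in\<close> lie inside the space, so complementing twice
  gives the set back and the existential witness disappears.\<close>

lemma pi02_in_iff: "pi02_in X A \<longleftrightarrow> A \<subseteq> topspace X \<and> sigma02_in X (topspace X - A)"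
  unfolding pi02_in_def using sigma02_in_subset by (metis Diff_subset double_diff order_refl)

lemma pi02_in_openin: "openin X U \<Longrightarrow> pi02_in X U"
  by (simp add: pi02_in_iff openin_subset sigma02_in_diff)

lemma pi02_in_closedin: "closedin X C \<Longrightarrow> pi02_in X C"
  using sigma02_in_diff[of X "topspace X - C" "{}"]
  by (auto simp: pi02_in_iff closedin_def)

lemma pi02_in_INT:
  fixes A :: "'i::countable \<Rightarrow> 'a set"
  assumes "\<And>i. pi02_in X (A i)"
  shows "pi02_in X (\<Inter>i. A i)"
proof -
  have "sigma02_in X (\<Union>i. topspace X - A i)"
    using assms by (intro sigma02_in_UN) (simp add: pi02_in_iff)
  \<comment> \<open>Index types are inhabited, so some member of the family bounds the
    intersection.\<close>
  moreover have "(\<Inter>i. A i) \<subseteq> topspace X"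
    using assms[of undefined] by (auto simp: pi02_in_iff)
  ultimately show ?thesis unfolding pi02_in_iff by simp
qed

lemma pi02_in_Int: "pi02_in X A \<Longrightarrow> pi02_in X B \<Longrightarrow> pi02_in X (A \<inter> B)"
  unfolding pi02_in_iff Diff_Int by (simp add: sigma02_in_Un le_infI1)

lemma pi02_in_Un: "pi02_in X A \<Longrightarrow> pi02_in X B \<Longrightarrow> pi02_in X (A \<union> B)"
  unfolding pi02_in_iff Diff_Un by (simp add: sigma02_in_Int)

text \<open>Open sets of \<open>Y\<close> extend to open sets of \<open>X\<close>. An extension may
  pick up points outside \<open>Y\<close>, but these lie outside \<open>Q\<close> as well, so adding
  the complement of \<open>Y\<close> absorbs them.\<close>

lemma pi02_in_subtopology_trans:
  assumes "pi02_in X Y" "pi02_in (subtopology X Y) Q"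
  shows "pi02_in X Q"
proof -
  have Y: "Y \<subseteq> topspace X" "sigma02_in X (topspace X - Y)" using assms(1) by (auto simp: pi02_in_iff)
  have QY: "Q \<subseteq> Y" and top: "topspace (subtopology X Y) = Y"
    using assms(2) Y(1) by (auto simp: pi02_in_iff)
  have YQ: "sigma02_in (subtopology X Y) (Y - Q)"
    using assms(2) unfolding pi02_in_iff top by blast
  obtain U V where UV: "\<forall>i. openin (subtopology X Y) (U i)" "\<forall>i. openin (subtopology X Y) (V i)"
    "Y - Q = (\<Union>i::nat. U i - V i)"
    by (rule sigma02_inE[OF YQ])
  have "\<forall>i. \<exists>W. openin X W \<and> U i = W \<inter> Y" "\<forall>i. \<exists>W. openin X W \<and> V i = W \<inter> Y"
    using UV(1,2) by (simp_all add: openin_subtopology)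
  then obtain U' V' where UV': "\<And>i. openin X (U' i)" "\<And>i. openin X (V' i)"
    "\<And>i. U i = U' i \<inter> Y" "\<And>i. V i = V' i \<inter> Y"
    by metis
  have "topspace X - Q = (topspace X - Y) \<union> (\<Union>i::nat. U' i - V' i)"
  proof -
    have U': "U' i \<subseteq> topspace X" for i using UV' openin_subset by blast
    have *: "y \<in> U' i - V' i \<longleftrightarrow> y \<in> U i - V i" if "y \<in> Y" for y i
      using UV' that by blast
    show ?thesis
    proof (rule set_eqI)
      fix y
      show "y \<in> topspace X - Q \<longleftrightarrow> y \<in> (topspace X - Y) \<union> (\<Union>i. U' i - V' i)"
      proof (cases "y \<in> Y")
        case True
        have "y \<in> Y - Q \<longleftrightarrow> y \<in> (\<Union>i. U i - V i)" by (simp only: UV(3))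
        then show ?thesis using True Y(1) * by auto
      next
        case False
        then show ?thesis using U' QY by blast
      qed
    qed
  qed
  moreover have "sigma02_in X (\<Union>i::nat. U' i - V' i)"
    using UV' by (intro sigma02_in_UN sigma02_in_diff) simp_all
  ultimately show ?thesis using Y QY by (simp add: pi02_in_iff sigma02_in_Un)
qed

section \<open>Neighbourhood bases\<close>

text \<open>The bases decrease, so that sets chosen inside \<open>B x n\<close> at stage
  \<open>n\<close> automatically converge to \<open>x\<close>.\<close>

definition neighbourhood_bases :: "'a topology \<Rightarrow> ('a \<Rightarrow> nat \<Rightarrow> 'a set) \<Rightarrow> bool" where
  "neighbourhood_bases X B \<longleftrightarrow>
     (\<forall>x n. openin X (B x n)) \<and> (\<forall>x\<in>topspace X. \<forall>n. x \<in> B x n) \<and> (\<forall>x. decseq (B x)) \<and>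
     (\<forall>x W. openin X W \<and> x \<in> W \<longrightarrow> (\<exists>n. B x n \<subseteq> W))"

lemma neighbourhood_basesD:
  assumes "neighbourhood_bases X B"
  shows "openin X (B x n)" "x \<in> topspace X \<Longrightarrow> x \<in> B x n" "m \<le> n \<Longrightarrow> B x n \<subseteq> B x m"
    "openin X W \<Longrightarrow> x \<in> W \<Longrightarrow> \<exists>n. B x n \<subseteq> W"
  using assms unfolding neighbourhood_bases_def decseq_def by simp_all

text \<open>\<open>B x n\<close> is the intersection of those among the first \<open>n + 1\<close>
  basic open sets that contain \<open>x\<close>.\<close>

lemma second_countable_neighbourhood_bases:
  assumes "second_countable X"
  obtains B where "neighbourhood_bases X B"
proof -
  obtain \<B> where \<B>: "countable \<B> \<and> (\<forall>V\<in>\<B>. openin X V) \<and>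
      (\<forall>U x. openin X U \<and> x \<in> U \<longrightarrow> (\<exists>V\<in>\<B>. x \<in> V \<and> V \<subseteq> U))"
    using assms unfolding second_countable_def ..
  let ?\<B> = "insert (topspace X) \<B>"
  define b where "b = from_nat_into ?\<B>"
  have b: "range b = ?\<B>"
    unfolding b_def using \<B> by (intro range_from_nat_into) auto
  then have b_open: "openin X (b n)" for n
    using \<B> by (metis insert_iff openin_topspace range_eqI)
  define B where "B = (\<lambda>x n. topspace X \<inter> \<Inter>{b i | i. i \<le> n \<and> x \<in> b i})"
  have eq: "B x n = \<Inter>(insert (topspace X) (b ` {i. i \<le> n \<and> x \<in> b i}))" for x n
    unfolding B_def by auto
  have "neighbourhood_bases X B"
    unfolding neighbourhood_bases_def
  proof (intro conjI allI ballI impI)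
    show "openin X (B x n)" for x n
      unfolding eq using b_open by (intro openin_Inter) auto
    show "x \<in> B x n" if "x \<in> topspace X" for x n
      using that unfolding B_def by auto
    show "decseq (B x)" for x
      unfolding B_def decseq_def by (auto intro: le_trans)
    fix x W assume W: "openin X W \<and> x \<in> W"
    then have "\<exists>V\<in>\<B>. x \<in> V \<and> V \<subseteq> W" using \<B> by simp
    then obtain V where V: "V \<in> \<B>" "x \<in> V" "V \<subseteq> W" by blast
    then have "V \<in> range b" using b by simp
    then obtain n where "V = b n" ..
    then have "B x n \<subseteq> V" unfolding B_def using V by auto
    then show "\<exists>n. B x n \<subseteq> W" using V by blast
  qed
  then show thesis by (rule that)
qed

text \<open>A point in the closure of \<open>{x}\<close> that lies in every neighbourhood of
  \<open>x\<close> has the same neighbourhoods as \<open>x\<close>, hence equals \<open>x\<close> by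
  \<open>t0_space\<close>.\<close>

lemma pi02_in_singleton:
  assumes "second_countable X" "t0_space X" "x \<in> topspace X"
  shows "pi02_in X {x}"
proof -
  obtain B where B: "neighbourhood_bases X B"
    using second_countable_neighbourhood_bases[OF assms(1)] .
  note B = neighbourhood_basesD[OF B]
  have eq: "{x} = X closure_of {x} \<inter> (\<Inter>n. B x n)"
  proof (intro equalityI subsetI)
    fix y assume "y \<in> {x}"
    then show "y \<in> X closure_of {x} \<inter> (\<Inter>n. B x n)"
      using B(2) assms(3) by (auto simp: in_closure_of)
  next
    fix y assume y: "y \<in> X closure_of {x} \<inter> (\<Inter>n. B x n)"
    then have "y \<in> topspace X" "\<And>U. openin X U \<Longrightarrow> y \<in> U \<Longrightarrow> x \<in> U" by (auto simp: in_closure_of)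
    moreover have "y \<in> U" if "openin X U" "x \<in> U" for U using that B(4)[of U x] y by blast
    ultimately have "x = y" using assms(2,3) unfolding t0_space_def by metis
    then show "y \<in> {x}" by simp
  qed
  have "pi02_in X (X closure_of {x} \<inter> (\<Inter>n. B x n))"
    using B(1) by (intro pi02_in_Int pi02_in_INT pi02_in_closedin pi02_in_openin) auto
  then show ?thesis by (simp only: eq[symmetric])
qed

text \<open>This encodes the condition that membership in \<open>U\<close> forces being
  \<open>x\<close> or lying in \<open>V\<close>. Both constructions below cut out their sets of
  points by countably many such conditions.\<close>

lemma pi02_in_open_imp_point_or_open:
  assumes "second_countable X" "t0_space X" "x \<in> topspace X" "openin X U" "openin X V"
  shows "pi02_in X ((topspace X - U) \<union> {x} \<union> V)"
  using assms by (intro pi02_in_Un pi02_in_singleton pi02_in_closedin pi02_in_openin) auto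

section \<open>Baire spaces\<close>

lemma dense_in_iff:
  "dense_in X S \<longleftrightarrow> S \<subseteq> topspace X \<and> (\<forall>U. openin X U \<and> U \<noteq> {} \<longrightarrow> U \<inter> S \<noteq> {})"
proof -
  have "X closure_of S = topspace X \<longleftrightarrow> (\<forall>U. openin X U \<and> U \<noteq> {} \<longrightarrow> U \<inter> S \<noteq> {})"
    by (subst inf_commute) (metis dense_intersects_open inf_commute)
  then show ?thesis unfolding dense_in_def by simp
qed

lemma dense_inI:
  assumes "S \<subseteq> topspace X" "\<And>U. openin X U \<Longrightarrow> U \<noteq> {} \<Longrightarrow> U \<inter> S \<noteq> {}"
  shows "dense_in X S"
  using assms by (simp add: dense_in_iff)

lemma dense_inD:
  assumes "dense_in X S" "openin X U" "U \<noteq> {}"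
  shows "U \<inter> S \<noteq> {}"
  using assms by (simp add: dense_in_iff)

text \<open>Finite intersections of dense open sets are dense, so the family may be replaced by a
  decreasing sequence. The whole space is adjoined to have a non-empty family to enumerate.\<close>

lemma not_Baire_spaceE:
  assumes "\<not> Baire_space X"
  obtains U and D :: "nat \<Rightarrow> 'a set" where "openin X U" "U \<noteq> {}" "decseq D"
    "\<And>n. openin X (D n)" "\<And>n. dense_in X (D n)" "U \<inter> (\<Inter>n. D n) = {}"
proof -
  obtain \<U> where \<U>: "countable \<U>" "\<And>U. U \<in> \<U> \<Longrightarrow> openin X U" "\<And>U. U \<in> \<U> \<Longrightarrow> dense_in X U"
    "\<not> dense_in X (topspace X \<inter> \<Inter>\<U>)"
    using assms unfolding Baire_space_def by blast
  then obtain U where U: "openin X U" "U \<noteq> {}" "U \<inter> (topspace X \<inter> \<Inter>\<U>) = {}"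
    unfolding dense_in_iff by blast
  let ?\<U> = "insert (topspace X) \<U>"
  define d where "d = from_nat_into ?\<U>"
  have d: "range d = ?\<U>"
    unfolding d_def using \<U>(1) by (intro range_from_nat_into) auto
  have top: "openin X (topspace X)" "dense_in X (topspace X)"
    unfolding dense_in_iff by (auto dest: openin_subset)
  have d': "openin X (d n) \<and> dense_in X (d n)" for n
    using d \<U>(2,3) top by (metis insert_iff range_eqI)
  define D where "D = (\<lambda>n. \<Inter>i\<le>n. d i)"
  have D_open: "openin X (D n)" for n
    unfolding D_def using d' by (intro openin_Inter) auto
  have D_Suc: "D (Suc n) = D n \<inter> d (Suc n)" for n
    unfolding D_def by (auto simp: atMost_Suc)
  have "dense_in X (D n)" for n
  proof (induction n)
    case 0
    then show ?case using d' by (simp add: D_def)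
  next
    case (Suc n)
    show ?case
    proof (rule dense_inI)
      show "D (Suc n) \<subseteq> topspace X" using D_open openin_subset by blast
      fix V assume V: "openin X V" "V \<noteq> {}"
      have "(V \<inter> D n) \<inter> d (Suc n) \<noteq> {}"
        using d' V D_open dense_inD[OF Suc.IH V] by (intro dense_inD[of X "d (Suc n)"]) auto
      then show "V \<inter> D (Suc n) \<noteq> {}" unfolding D_Suc by (simp add: Int_assoc)
    qed
  qed
  moreover have "decseq D" unfolding D_def decseq_def by (auto intro: le_trans)
  moreover have "U \<inter> (\<Inter>n. D n) = {}"
  proof -
    have "(\<Inter>n. D n) = \<Inter>(range d)" unfolding D_def by auto
    then show ?thesis using U d by auto
  qed
  ultimately show thesis using that U D_open by blast
qed

text \<open>\<open>A\<close> contains the intersection of countably many dense open sets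
  \<open>W i\<close> of \<open>C\<close>, and dense open subsets of \<open>A\<close> are traces of
  dense open subsets of \<open>C\<close>. The Baire property of \<open>C\<close> handles both
  families together.\<close>

lemma Baire_space_dense_pi02:
  assumes C: "Baire_space C" and A: "pi02_in C A" "dense_in C A"
  shows "Baire_space (subtopology C A)"
  unfolding Baire_space_def
proof (intro allI impI, elim conjE)
  fix \<D>
  assume \<D>: "countable \<D>" "\<forall>D\<in>\<D>. openin (subtopology C A) D \<and> dense_in (subtopology C A) D"
  have sub: "A \<subseteq> topspace C" using A(1) by (simp add: pi02_in_iff)
  then have top: "topspace (subtopology C A) = A" by auto
  have "sigma02_in C (topspace C - A)" using A(1) by (simp add: pi02_in_iff)
  obtain U V where UV: "\<forall>i. openin C (U i)" "\<forall>i. openin C (V i)"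
    "topspace C - A = (\<Union>i::nat. U i - V i)"
    by (rule sigma02_inE[OF \<open>sigma02_in C (topspace C - A)\<close>])
  \<comment> \<open>A point of \<open>U i\<close> survives in \<open>W i\<close> only if it lies in
    \<open>V i\<close>, so the intersection of all \<open>W i\<close> stays inside \<open>A\<close>.
    Removing the whole closure of \<open>U i\<close> keeps \<open>W i\<close> open.\<close>
  define W where "W = (\<lambda>i. V i \<union> (topspace C - C closure_of U i))"
  have W_open: "openin C (W i)" for i
    unfolding W_def using UV by (auto intro!: openin_Un openin_diff)
  \<comment> \<open>A non-empty open set missing \<open>W i\<close> would meet \<open>U i\<close>,
    and then \<open>A\<close>, in a point of \<open>U i - V i\<close>; but that difference is
    disjoint from \<open>A\<close>.\<close>
  have W_dense: "T \<inter> W i \<noteq> {}" if T: "openin C T" "T \<noteq> {}" for T i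
  proof
    assume *: "T \<inter> W i = {}"
    have "T \<subseteq> topspace C" using T openin_subset by blast
    then have "T \<inter> C closure_of U i \<noteq> {}" using * T unfolding W_def by blast
    then have "T \<inter> U i \<noteq> {}"
      using openin_Int_closure_of_eq_empty[OF T(1)] by metis
    then have "(T \<inter> U i) \<inter> A \<noteq> {}"
      using T UV(1) by (intro dense_inD[OF A(2)]) auto
    then show False using * UV(3) unfolding W_def by blast
  qed
  have W_sub: "topspace C \<inter> (\<Inter>i. W i) \<subseteq> A"
  proof
    fix y assume y: "y \<in> topspace C \<inter> (\<Inter>i. W i)"
    have "\<not> (y \<in> U i - V i)" for i
    proof -
      have "y \<in> W i" using y by blast
      moreover have "U i \<subseteq> C closure_of U i" using UV(1) by (simp add: closure_of_subset openin_subset)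
      ultimately show ?thesis unfolding W_def by blast
    qed
    then show "y \<in> A" using UV(3) y by blast
  qed
  have "\<forall>D\<in>\<D>. \<exists>D'. openin C D' \<and> D = D' \<inter> A" using \<D>(2) unfolding openin_subtopology by blast
  then obtain E where E: "\<And>D. D \<in> \<D> \<Longrightarrow> openin C (E D)" "\<And>D. D \<in> \<D> \<Longrightarrow> D = E D \<inter> A" by metis
  have E_dense: "T \<inter> E D \<noteq> {}" if T: "openin C T" "T \<noteq> {}" and D: "D \<in> \<D>" for T D
  proof -
    have "T \<inter> A \<noteq> {}" using dense_inD[OF A(2) T] .
    moreover have "openin (subtopology C A) (T \<inter> A)" using T by (auto simp: openin_subtopology)
    moreover have "dense_in (subtopology C A) D" using \<D>(2) D by blast
    ultimately have "(T \<inter> A) \<inter> D \<noteq> {}" by (metis dense_inD)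
    then show ?thesis using E(2)[OF D] by blast
  qed
  have dense: "dense_in C (topspace C \<inter> \<Inter>(range W \<union> E ` \<D>))"
  proof -
    have "countable (range W \<union> E ` \<D>)" using \<D>(1) by simp
    moreover have "openin C G \<and> dense_in C G" if "G \<in> range W \<union> E ` \<D>" for G
    proof
      show "openin C G" using that W_open E(1) by auto
      show "dense_in C G"
      proof (rule dense_inI)
        show "G \<subseteq> topspace C" using \<open>openin C G\<close> openin_subset by blast
        show "T \<inter> G \<noteq> {}" if "openin C T" "T \<noteq> {}" for T
          using \<open>G \<in> _\<close> W_dense[OF that] E_dense[OF that] by auto
      qed
    qed
    ultimately show ?thesis using C unfolding Baire_space_def by blast
  qed
  show "dense_in (subtopology C A) (topspace (subtopology C A) \<inter> \<Inter>\<D>)"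
    unfolding top
  proof (rule dense_inI)
    show "A \<inter> \<Inter>\<D> \<subseteq> topspace (subtopology C A)" unfolding top by blast
    fix G assume "openin (subtopology C A) G" "G \<noteq> {}"
    then obtain T where T: "openin C T" "G = T \<inter> A" "T \<noteq> {}" by (auto simp: openin_subtopology)
    obtain y where y: "y \<in> T" "y \<in> topspace C" "y \<in> \<Inter>(range W \<union> E ` \<D>)"
      using dense_inD[OF dense T(1,3)] by blast
    then have "y \<in> A" using W_sub by blast
    moreover have "y \<in> D" if "D \<in> \<D>" for D
      using y \<open>y \<in> A\<close> E(2)[OF that] that by blast
    ultimately show "G \<inter> (A \<inter> \<Inter>\<D>) \<noteq> {}" using T(2) y(1) by blast
  qed
qed

text \<open>\<open>A\<close> is a dense \<Pi>02-subset of its closure, which is a Baire space by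
  assumption.\<close>

lemma completely_Baire_space_pi02:
  assumes "completely_Baire_space X" "pi02_in X A"
  shows "Baire_space (subtopology X A)"
proof -
  let ?C = "X closure_of A"
  have A: "A \<subseteq> topspace X" using assms(2) by (simp add: pi02_in_iff)
  then have AC: "A \<subseteq> ?C" by (simp add: closure_of_subset)
  have "sigma02_in X (topspace X - A)" using assms(2) by (simp add: pi02_in_iff)
  obtain U V where UV: "\<forall>i. openin X (U i)" "\<forall>i. openin X (V i)"
    "topspace X - A = (\<Union>i::nat. U i - V i)"
    by (rule sigma02_inE[OF \<open>sigma02_in X (topspace X - A)\<close>])
  have top: "topspace (subtopology X ?C) = ?C"
    by (simp add: closure_of_subset_topspace inf.absorb2)
  have "?C - A = (\<Union>i. (U i \<inter> ?C) - (V i \<inter> ?C))"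
    using UV(3) closure_of_subset_topspace[of X A] by blast
  moreover have "sigma02_in (subtopology X ?C) (\<Union>i. (U i \<inter> ?C) - (V i \<inter> ?C))"
    using UV(1,2) by (intro sigma02_in_UN sigma02_in_diff) (auto simp: openin_subtopology)
  ultimately have "pi02_in (subtopology X ?C) A"
    unfolding pi02_in_iff top using AC by simp
  moreover have "dense_in (subtopology X ?C) A"
    unfolding dense_in_def top using AC by (simp add: closure_of_subtopology inf.absorb2)
  moreover have "Baire_space (subtopology X ?C)"
    using assms(1) unfolding completely_Baire_space_def by simp
  ultimately have "Baire_space (subtopology (subtopology X ?C) A)" by (rule Baire_space_dense_pi02[rotated])
  then show ?thesis using AC by (simp add: subtopology_subtopology inf.absorb2)
qed

text \<open>The complements of the closures of points are countably many dense open sets, and their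
  intersection is empty because each point is missing from its own.\<close>

lemma countable_perfect_TD_not_Baire:
  assumes "Baire_space X" "countable (topspace X)" "topspace X \<noteq> {}" "perfect_space X" "TD_space X"
  shows False
proof -
  let ?D = "(\<lambda>x. topspace X - X closure_of {x}) ` topspace X"
  have "countable ?D" using assms(2) by simp
  moreover have "openin X G \<and> dense_in X G" if G: "G \<in> ?D" for G
  proof -
    obtain x where x: "x \<in> topspace X" "G = topspace X - X closure_of {x}" using G by blast
    obtain U C where UC: "openin X U" "closedin X C" "{x} = U \<inter> C"
      using assms(5) x(1) unfolding TD_space_def locally_closed_in_def by metis
    have cl: "X closure_of {x} \<subseteq> C" using UC by (intro closure_of_minimal) auto
    have dense: "T \<inter> G \<noteq> {}" if T: "openin X T" "T \<noteq> {}" for T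
    proof
      assume "T \<inter> G = {}"
      then have sub: "T \<subseteq> X closure_of {x}" using x T openin_subset by blast
      then obtain y where "y \<in> T" "y \<in> X closure_of {x}" using T by blast
      then have "x \<in> T" using T by (auto simp: in_closure_of)
      \<comment> \<open>Local closedness isolates \<open>x\<close> inside \<open>T\<close>, which
        would make \<open>{x}\<close> a finite non-empty open set.\<close>
      then have "T \<inter> U = {x}" using sub cl UC(3) by blast
      then have "openin X {x}" using T(1) UC(1) by (metis openin_Int)
      then show False using assms(4) unfolding perfect_space_def by blast
    qed
    have "openin X G" unfolding x by (intro openin_diff) auto
    then show ?thesis using dense openin_subset by (intro conjI dense_inI) auto
  qed
  ultimately have "dense_in X (topspace X \<inter> \<Inter>?D)" using assms(1) unfolding Baire_space_def by blast
  moreover have "topspace X \<inter> \<Inter>?D = {}"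
    using closure_of_subset[of "{x}" X for x] by blast
  ultimately have "dense_in X {}" by simp
  then show False using dense_inD[of X "{}" "topspace X"] assms(3) by simp
qed

section \<open>The three test spaces\<close>

lemma homeomorphic_space_perfect_space:
  assumes "X homeomorphic_space Y" "perfect_space X"
  shows "perfect_space Y"
proof -
  obtain f where f: "homeomorphic_map Y X f"
    using assms(1) homeomorphic_space homeomorphic_space_sym by blast
  show ?thesis
    unfolding perfect_space_def
  proof (intro allI impI, elim conjE)
    fix U assume U: "openin Y U" "U \<noteq> {}"
    then have "openin X (f ` U)"
      using f homeomorphic_imp_open_map open_map_def by blast
    then have "infinite (f ` U)"
      using assms(2) U(2) unfolding perfect_space_def by blast
    then show "infinite U" by blast
  qed
qed

lemma homeomorphic_space_TD_space:
  assumes "X homeomorphic_space Y" "TD_space X"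
  shows "TD_space Y"
proof -
  obtain f where f: "homeomorphic_map X Y f"
    using assms(1) homeomorphic_space by blast
  then have inj: "inj_on f (topspace X)" and surj: "f ` topspace X = topspace Y"
    by (auto simp: homeomorphic_map_def quotient_map_def)
  show ?thesis
    unfolding TD_space_def
  proof
    fix y assume "y \<in> topspace Y"
    then obtain x where x: "x \<in> topspace X" "y = f x" using surj by blast
    then obtain U C where UC: "openin X U" "closedin X C" "{x} = U \<inter> C"
      using assms(2) unfolding TD_space_def locally_closed_in_def by metis
    have "openin Y (f ` U)" "closedin Y (f ` C)"
      using f UC homeomorphic_imp_open_map homeomorphic_imp_closed_map
      unfolding open_map_def closed_map_def by blast+
    moreover have "{y} = f ` U \<inter> f ` C"
      using inj UC x openin_subset[OF UC(1)] closedin_subset[OF UC(2)]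
      by (subst inj_on_image_Int[symmetric, of f "topspace X"]) auto
    ultimately show "locally_closed_in Y {y}"
      unfolding locally_closed_in_def by blast
  qed
qed

lemma TD_space_if_closed_points:
  assumes "\<And>x. x \<in> topspace X \<Longrightarrow> closedin X {x}"
  shows "TD_space X"
  unfolding TD_space_def locally_closed_in_def
  using assms by (metis inf.absorb_iff2 openin_topspace closedin_subset)

lemma S\<^sub>D_perfect_TD: "perfect_space S\<^sub>D" "TD_space S\<^sub>D"
proof -
  have "infinite {m. n \<le> m}" for n :: nat
    using infinite_Ici[of n] by (simp add: atLeast_def)
  then show "perfect_space S\<^sub>D"
    unfolding perfect_space_def openin_S\<^sub>D by blast
  have "locally_closed_in S\<^sub>D {n}" for n
  proof -
    have "openin S\<^sub>D {m. n \<le> m}" "openin S\<^sub>D {m. Suc n \<le> m}" by (auto simp: openin_S\<^sub>D)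
    moreover have "{n} = {m. n \<le> m} \<inter> (UNIV - {m. Suc n \<le> m})" by auto
    moreover have "closedin S\<^sub>D (UNIV - {m. Suc n \<le> m})"
      using openin_closedin_eq[of "S\<^sub>D" "{m. Suc n \<le> m}"] calculation(2) by simp
    ultimately show ?thesis unfolding locally_closed_in_def by blast
  qed
  then show "TD_space S\<^sub>D" unfolding TD_space_def by simp
qed

lemma S\<^sub>1_perfect_TD: "perfect_space S\<^sub>1" "TD_space S\<^sub>1"
proof -
  show "perfect_space S\<^sub>1"
    unfolding perfect_space_def openin_S\<^sub>1
    by (metis Compl_eq_Diff_UNIV finite_compl infinite_UNIV_nat)
  show "TD_space S\<^sub>1"
    by (rule TD_space_if_closed_points) (simp add: closedin_def openin_S\<^sub>1 double_compl Compl_eq_Diff_UNIV[symmetric])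
qed

lemma topspace_S\<^sub>2 [simp]: "topspace S\<^sub>2 = \<rat>"
  by (simp add: S\<^sub>2_def)

lemma openin_S\<^sub>2: "openin S\<^sub>2 V \<longleftrightarrow> (\<exists>T. open T \<and> V = T \<inter> \<rat>)"
  by (simp add: S\<^sub>2_def openin_subtopology)

lemma S\<^sub>2_perfect_TD: "perfect_space S\<^sub>2" "TD_space S\<^sub>2"
proof -
  show "perfect_space S\<^sub>2"
    unfolding perfect_space_def
  proof (intro allI impI, elim conjE)
    fix U assume "openin S\<^sub>2 U" "U \<noteq> {}"
    then obtain T x where T: "open T" "U = T \<inter> \<rat>" "x \<in> T"
      unfolding openin_S\<^sub>2 by auto
    then obtain e where e: "e > 0" "ball x e \<subseteq> T" using openE by blast
    show "infinite U"
    proof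
      assume "finite U"
      have "x islimpt \<rat>"
        unfolding islimpt_approachable_real
      proof (intro allI impI)
        fix d :: real assume "0 < d"
        then obtain q where "q \<in> \<rat>" "x < q" "q < x + d"
          using Rats_dense_in_real[of x "x + d"] by auto
        then show "\<exists>x'\<in>\<rat>. x' \<noteq> x \<and> \<bar>x' - x\<bar> < d" by (intro bexI[of _ q]) auto
      qed
      then have "infinite (\<rat> \<inter> ball x e)" using e(1) by (simp add: islimpt_eq_infinite_ball)
      moreover have "\<rat> \<inter> ball x e \<subseteq> U" using e T(2) by blast
      ultimately show False using \<open>finite U\<close> finite_subset by blast
    qed
  qed
  show "TD_space S\<^sub>2"
  proof (rule TD_space_if_closed_points)
    fix x assume "x \<in> topspace S\<^sub>2"
    then show "closedin S\<^sub>2 {x}"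
      unfolding S\<^sub>2_def by (auto simp: closedin_subtopology intro!: exI[of _ "{x}"])
  qed
qed

text \<open>Any copy of a test space violates (2), because the properties involved are invariant
  under homeomorphisms.\<close>

lemma homeomorphic_space_test_space:
  assumes "X homeomorphic_space S\<^sub>D \<or> X homeomorphic_space S\<^sub>1 \<or> X homeomorphic_space S\<^sub>2"
  shows "topspace X \<noteq> {}" "countable (topspace X)" "perfect_space X" "TD_space X"
proof -
  have *: "topspace X \<noteq> {} \<and> countable (topspace X) \<and> perfect_space X \<and> TD_space X"
    if "X homeomorphic_space Y" "topspace Y \<noteq> {}" "countable (topspace Y)" "perfect_space Y" "TD_space Y"
    for Y :: "'b topology"
  proof -
    have "Y homeomorphic_space X" using that(1) homeomorphic_space_sym by blast
    then obtain f where "homeomorphic_map Y X f" using homeomorphic_space by blast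
    then have "f ` topspace Y = topspace X" by (simp add: homeomorphic_map_def quotient_map_def)
    then show ?thesis
      using that \<open>Y homeomorphic_space X\<close> homeomorphic_space_perfect_space homeomorphic_space_TD_space
      by (metis countable_image image_is_empty)
  qed
  have **: "topspace X \<noteq> {} \<and> countable (topspace X) \<and> perfect_space X \<and> TD_space X"
    using assms
  proof (elim disjE)
    assume "X homeomorphic_space S\<^sub>D"
    from *[OF this] S\<^sub>D_perfect_TD show ?thesis by simp
  next
    assume "X homeomorphic_space S\<^sub>1"
    from *[OF this] S\<^sub>1_perfect_TD show ?thesis by simp
  next
    assume "X homeomorphic_space S\<^sub>2"
    from *[OF this] S\<^sub>2_perfect_TD show ?thesis
      by (metis Rats_0 countable_rat empty_iff topspace_S\<^sub>2)
  qed
  then show "topspace X \<noteq> {}" "countable (topspace X)" "perfect_space X" "TD_space X" by simp_all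
qed

text \<open>As \<open>x\<close> is a bijection onto its range, every subset of the range is the
  image of its preimage, so it suffices to compare open sets of indices with their images.\<close>

lemma homeomorphic_space_subtopology_range:
  assumes "inj x" "range x \<subseteq> topspace X" "topspace T = UNIV"
    and "\<And>W. openin (subtopology X (range x)) (x ` W) \<longleftrightarrow> openin T W"
  shows "subtopology X (range x) homeomorphic_space T"
proof -
  have "homeomorphic_map T (subtopology X (range x)) x"
    unfolding homeomorphic_map_def quotient_map_def
  proof (intro conjI allI impI)
    show "x ` topspace T = topspace (subtopology X (range x))" using assms(2,3) by auto
    show "inj_on x (topspace T)" using assms(1,3) by simp
    fix U assume "U \<subseteq> topspace (subtopology X (range x))"
    then have "x ` (x -` U) = U" by auto
    moreover have "{y \<in> topspace T. x y \<in> U} = x -` U" using assms(3) by auto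
    ultimately show "openin T {y \<in> topspace T. x y \<in> U} \<longleftrightarrow> openin (subtopology X (range x)) U"
      using assms(4)[of "x -` U"] by simp
  qed
  then show ?thesis using homeomorphic_map_imp_homeomorphic_space homeomorphic_space_sym by blast
qed

section \<open>Sequences with shrinking tails\<close>

text \<open>The sets \<open>U n\<close> may contain points outside the sequence.
  \<open>tails_small\<close> makes the sequence converge to each of its members, and
  \<open>tails_empty\<close> makes every point leave the tails eventually.\<close>

locale shrinking_tails =
  fixes X :: "'a topology" and x :: "nat \<Rightarrow> 'a" and U :: "nat \<Rightarrow> 'a set"
  assumes tail_open: "openin X (U n)"
    and tail_decseq: "decseq U"
    and point_in_tail: "x n \<in> U n"
    and point_notin_tail: "x n \<notin> U (Suc n)"
    and tails_empty: "(\<Inter>n. U n) = {}"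
    and tails_small: "openin X W \<Longrightarrow> x n \<in> W \<Longrightarrow> \<exists>m. U m \<subseteq> W"
begin

lemma tail_mono: "m \<le> n \<Longrightarrow> U n \<subseteq> U m"
  using tail_decseq by (simp add: decseq_def)

lemma point_in_tail_iff: "x m \<in> U n \<longleftrightarrow> n \<le> m"
proof
  assume "x m \<in> U n"
  show "n \<le> m"
  proof (rule ccontr)
    assume "\<not> n \<le> m"
    then have "U n \<subseteq> U (Suc m)" by (intro tail_mono) simp
    then show False using \<open>x m \<in> U n\<close> point_notin_tail by blast
  qed
next
  assume "n \<le> m"
  then show "x m \<in> U n" using tail_mono point_in_tail by blast
qed

lemma inj_x: "inj x"
  by (rule injI) (metis order_antisym order_refl point_in_tail_iff)

lemma range_subset: "range x \<subseteq> topspace X"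
  using point_in_tail tail_open openin_subset by blast

text \<open>A point of \<open>U 0\<close> leaves the tails at a first index, which must be a
  successor \<open>Suc n\<close>; the condition \<open>?P n\<close> then forces the point to be
  \<open>x n\<close>.\<close>

lemma pi02_in_range:
  assumes "second_countable X" "t0_space X"
  shows "pi02_in X (range x)"
proof -
  let ?P = "\<lambda>n. (topspace X - U n) \<union> {x n} \<union> U (Suc n)"
  have "range x = U 0 \<inter> (\<Inter>n. ?P n)"
  proof (intro equalityI subsetI)
    fix y assume "y \<in> range x"
    then obtain m where m: "y = x m" by blast
    have "y \<in> ?P n" for n
      using range_subset unfolding m by (cases n m rule: linorder_cases) (auto simp: point_in_tail_iff)
    moreover have "y \<in> U 0" unfolding m by (simp add: point_in_tail_iff)
    ultimately show "y \<in> U 0 \<inter> (\<Inter>n. ?P n)" by blast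
  next
    fix y assume y: "y \<in> U 0 \<inter> (\<Inter>n. ?P n)"
    obtain m where "y \<notin> U m" using tails_empty by blast
    define k where "k = (LEAST m. y \<notin> U m)"
    have k: "y \<notin> U k" unfolding k_def using \<open>y \<notin> U m\<close> by (rule LeastI)
    then obtain n where n: "k = Suc n" using y by (cases k) auto
    have "y \<in> U n" using not_less_Least[of n "\<lambda>m. y \<notin> U m"] n unfolding k_def by auto
    then have "y = x n" using y k n by blast
    then show "y \<in> range x" by blast
  qed
  moreover have "pi02_in X (U 0 \<inter> (\<Inter>n. ?P n))"
    using assms tail_open range_subset
    by (intro pi02_in_Int pi02_in_INT pi02_in_open_imp_point_or_open pi02_in_openin) auto
  ultimately show ?thesis by (simp only:)
qed

lemma openin_tail_image: "openin (subtopology X (range x)) (x ` {n..})"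
proof -
  have "x ` {n..} = U n \<inter> range x" by (auto simp: point_in_tail_iff)
  then show ?thesis using tail_open by (auto simp: openin_subtopology)
qed

lemma openin_imageE:
  assumes "openin (subtopology X (range x)) (x ` W)"
  obtains V where "openin X V" "\<And>i. i \<in> W \<longleftrightarrow> x i \<in> V"
proof -
  obtain V where V: "openin X V" "x ` W = V \<inter> range x"
    using assms by (auto simp: openin_subtopology)
  then have "i \<in> W \<longleftrightarrow> x i \<in> V" for i
    using inj_x by (metis IntE IntI inj_image_mem_iff rangeI)
  then show thesis using V(1) that by blast
qed

text \<open>The hypothesis makes the index set of a relatively open set upward closed, and a
  non-empty upward closed set of numbers is a final segment.\<close>

lemma homeomorphic_S\<^sub>D:
  assumes "\<And>i j V. i < j \<Longrightarrow> openin X V \<Longrightarrow> x i \<in> V \<Longrightarrow> x j \<in> V"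
  shows "subtopology X (range x) homeomorphic_space S\<^sub>D"
proof (rule homeomorphic_space_subtopology_range[OF inj_x range_subset topspace_S\<^sub>D])
  fix W
  show "openin (subtopology X (range x)) (x ` W) \<longleftrightarrow> openin S\<^sub>D W"
  proof
    assume W: "openin (subtopology X (range x)) (x ` W)"
    obtain V where V: "openin X V" "\<And>i. i \<in> W \<longleftrightarrow> x i \<in> V"
      using openin_imageE[OF W] by blast
    show "openin S\<^sub>D W"
    proof (cases "W = {}")
      case False
      define n where "n = (LEAST i. i \<in> W)"
      have "n \<in> W" unfolding n_def using False by (metis LeastI ex_in_conv)
      then have "m \<in> W" if "n \<le> m" for m
        using assms[of n m V] V that by (cases "n = m") auto
      moreover have "n \<le> m" if "m \<in> W" for m unfolding n_def using that by (rule Least_le)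
      ultimately have "W = {m. n \<le> m}" by blast
      then show ?thesis unfolding openin_S\<^sub>D by blast
    qed (simp add: openin_S\<^sub>D)
  next
    assume "openin S\<^sub>D W"
    then consider "W = {}" | n where "W = {n..}" unfolding openin_S\<^sub>D atLeast_def by blast
    then show "openin (subtopology X (range x)) (x ` W)"
      by cases (simp_all add: openin_tail_image)
  qed
qed

text \<open>An open set that meets the sequence contains a tail, so its index set is cofinite.
  Conversely, the hypothesis separates \<open>x i\<close> from later points and \<open>U i\<close>
  separates it from earlier ones; a cofinite set needs only finitely many of these separations at
  each point.\<close>

lemma homeomorphic_S\<^sub>1:
  assumes "\<And>i j. i < j \<Longrightarrow> \<exists>V. openin X V \<and> x i \<in> V \<and> x j \<notin> V"
  shows "subtopology X (range x) homeomorphic_space S\<^sub>1"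
proof (rule homeomorphic_space_subtopology_range[OF inj_x range_subset topspace_S\<^sub>1])
  fix W
  show "openin (subtopology X (range x)) (x ` W) \<longleftrightarrow> openin S\<^sub>1 W"
  proof
    assume W: "openin (subtopology X (range x)) (x ` W)"
    obtain V where V: "openin X V" "\<And>i. i \<in> W \<longleftrightarrow> x i \<in> V"
      using openin_imageE[OF W] by blast
    show "openin S\<^sub>1 W"
    proof (cases "W = {}")
      case False
      then obtain n where "x n \<in> V" using V(2) by blast
      then obtain m where "U m \<subseteq> V" using tails_small V(1) by blast
      then have "- W \<subseteq> {..<m}" using V(2) point_in_tail_iff by (metis ComplD lessThan_iff not_le subsetD subsetI)
      then show ?thesis unfolding openin_S\<^sub>1 using finite_subset by blast
    qed (simp add: openin_S\<^sub>1)
  next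
    assume "openin S\<^sub>1 W"
    show "openin (subtopology X (range x)) (x ` W)"
    proof (cases "W = {}")
      case False
      then have fin: "finite (- W)" using \<open>openin S\<^sub>1 W\<close> by (simp add: openin_S\<^sub>1)
      have ex: "\<exists>V. openin X V \<and> x i \<in> V \<and> x j \<notin> V" if "i \<noteq> j" for i j
      proof (cases "i < j")
        case True
        then show ?thesis by (rule assms)
      next
        case False
        then have "x i \<in> U i \<and> x j \<notin> U i" using that by (simp add: point_in_tail_iff)
        then show ?thesis using tail_open by blast
      qed
      then obtain V where V: "openin X (V i j)" "x i \<in> V i j" "x j \<notin> V i j" if "i \<noteq> j" for i j
        by metis
      \<comment> \<open>Intersecting with the space covers the case that \<open>- W\<close> is
        empty.\<close>
      define G where "G = (\<Union>i\<in>W. topspace X \<inter> (\<Inter>j\<in>- W. V i j))"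
      have "openin X (topspace X \<inter> (\<Inter>j\<in>- W. V i j))" if "i \<in> W" for i
      proof -
        have "openin X K" if "K \<in> insert (topspace X) (V i ` (- W))" for K
        proof (cases "K = topspace X")
          case False
          then obtain j where "j \<in> - W" "K = V i j" using \<open>K \<in> _\<close> by blast
          then show ?thesis using V(1)[of i j] \<open>i \<in> W\<close> by blast
        qed simp
        then have "openin X (\<Inter>(insert (topspace X) (V i ` (- W))))"
          using fin by (intro openin_Inter) simp_all
        then show ?thesis by simp
      qed
      then have "openin X G" unfolding G_def by blast
      moreover have "x ` W = G \<inter> range x"
      proof (intro equalityI subsetI)
        fix y assume "y \<in> x ` W"
        then obtain i where i: "i \<in> W" "y = x i" by blast
        have "y \<in> V i j" if "j \<in> - W" for j unfolding i(2) using i(1) that by (intro V(2)) auto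
        then show "y \<in> G \<inter> range x" unfolding G_def using range_subset i by auto
      next
        fix y assume "y \<in> G \<inter> range x"
        then obtain i k where ik: "i \<in> W" "y = x k" "\<And>j. j \<in> - W \<Longrightarrow> x k \<in> V i j"
          unfolding G_def by auto
        have "k \<in> W"
        proof (rule ccontr)
          assume "k \<notin> W"
          moreover have "i \<noteq> k" using ik(1) \<open>k \<notin> W\<close> by blast
          ultimately show False using V(3)[of i k] ik(3)[of k] by simp
        qed
        then show "y \<in> x ` W" using ik(2) by simp
      qed
      ultimately show ?thesis by (auto simp: openin_subtopology)
    qed simp
  qed
qed

lemma shrinking_tails_subsequence:
  assumes r: "strict_mono r"
  shows "shrinking_tails X (x \<circ> r) (U \<circ> r)"
proof
  fix n
  show "openin X ((U \<circ> r) n)" using tail_open by simp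
  show "(x \<circ> r) n \<in> (U \<circ> r) n" by (simp add: point_in_tail_iff)
  show "(x \<circ> r) n \<notin> (U \<circ> r) (Suc n)" using r by (simp add: point_in_tail_iff strict_mono_less_eq)
next
  show "decseq (U \<circ> r)" using r tail_mono by (simp add: decseq_def strict_mono_less_eq)
  show "(\<Inter>n. (U \<circ> r) n) = {}"
    using tails_empty tail_mono[OF seq_suble[OF r]] by fastforce
next
  fix W n assume "openin X W" "(x \<circ> r) n \<in> W"
  then obtain m where "U m \<subseteq> W" using tails_small[of W "r n"] by auto
  then show "\<exists>m. (U \<circ> r) m \<subseteq> W" using tail_mono[OF seq_suble[OF r]] by (metis comp_apply order_trans)
qed

text \<open>A pair \<open>i < j\<close> is coloured by whether \<open>x i\<close> lies below \<open>x j\<close> in the specialization order.\<close>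

lemma ex_pi02_S\<^sub>D_or_S\<^sub>1:
  assumes "second_countable X" "t0_space X"
  shows "\<exists>Q. pi02_in X Q \<and> (subtopology X Q homeomorphic_space S\<^sub>D \<or> subtopology X Q homeomorphic_space S\<^sub>1)"
proof -
  define below where "below = (\<lambda>i j. \<forall>V. openin X V \<and> x i \<in> V \<longrightarrow> x j \<in> V)"
  \<comment> \<open>\<open>Min\<close> and \<open>Max\<close> recover the order of a pair, so a
    directed relation can colour unordered pairs.\<close>
  define c :: "nat set \<Rightarrow> nat" where "c = (\<lambda>P. if below (Min P) (Max P) then 0 else 1)"
  have "\<forall>i\<in>UNIV. \<forall>j\<in>UNIV. i \<noteq> j \<longrightarrow> c {i, j} < 2" by (simp add: c_def)
  from Ramsey2[OF infinite_UNIV_nat this] obtain Y t where Y: "infinite Y"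
    "\<forall>i\<in>Y. \<forall>j\<in>Y. i \<noteq> j \<longrightarrow> c {i, j} = t" by blast
  define r where "r = enumerate Y"
  have r: "strict_mono r" unfolding r_def using Y(1) by (rule strict_mono_enumerate)
  interpret sub: shrinking_tails X "x \<circ> r" "U \<circ> r"
    by (rule shrinking_tails_subsequence[OF r])
  have rY: "r i \<in> Y" for i unfolding r_def using Y(1) by (rule enumerate_in_set)
  have c: "(if below (r i) (r j) then 0 else 1) = t" if "i < j" for i j
  proof -
    have "r i < r j" using r that by (simp add: strict_mono_less)
    then have "c {r i, r j} = (if below (r i) (r j) then 0 else 1)" by (simp add: c_def min_absorb1 max_absorb2)
    moreover have "c {r i, r j} = t" using Y(2) rY \<open>r i < r j\<close> by (metis less_irrefl)
    ultimately show ?thesis by simp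
  qed
  \<comment> \<open>Colour 0 on the homogeneous set means an increasing chain in the specialization
    order; colour 1 means that no point lies below a later one.\<close>
  have "subtopology X (range (x \<circ> r)) homeomorphic_space S\<^sub>D
    \<or> subtopology X (range (x \<circ> r)) homeomorphic_space S\<^sub>1"
  proof (cases "t = 0")
    case True
    then have "below (r i) (r j)" if "i < j" for i j using c[OF that] by (auto split: if_splits)
    then show ?thesis unfolding below_def by (intro disjI1 sub.homeomorphic_S\<^sub>D) auto
  next
    case False
    then have "\<not> below (r i) (r j)" if "i < j" for i j using c[OF that] by (auto split: if_splits)
    then show ?thesis unfolding below_def by (intro disjI2 sub.homeomorphic_S\<^sub>1) auto
  qed
  then show ?thesis using sub.pi02_in_range[OF assms] by blast
qed

end

section \<open>Branching points\<close>

definition branching :: "'a topology \<Rightarrow> 'a \<Rightarrow> bool" where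
  "branching X x \<longleftrightarrow>
     (\<forall>W. openin X W \<and> x \<in> W \<longrightarrow>
        (\<exists>N V. openin X N \<and> x \<in> N \<and> openin X V \<and> V \<noteq> {} \<and> V \<subseteq> W \<and> V \<inter> N = {}))"

text \<open>Read positively, every neighbourhood of \<open>x\<close> is dense in
  \<open>W\<close>.\<close>

lemma not_branchingE:
  assumes "\<not> branching X x"
  obtains W where "openin X W" "x \<in> W"
    "\<And>N V. openin X N \<Longrightarrow> x \<in> N \<Longrightarrow> openin X V \<Longrightarrow> V \<noteq> {} \<Longrightarrow> V \<subseteq> W \<Longrightarrow> V \<inter> N \<noteq> {}"
proof -
  obtain W where W: "openin X W \<and> x \<in> W \<and>
      \<not> (\<exists>N V. openin X N \<and> x \<in> N \<and> openin X V \<and> V \<noteq> {} \<and> V \<subseteq> W \<and> V \<inter> N = {})"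
    using assms unfolding branching_def by blast
  show thesis
  proof (rule that[of W])
    show "openin X W" "x \<in> W" using W by blast+
    show "V \<inter> N \<noteq> {}" if "openin X N" "x \<in> N" "openin X V" "V \<noteq> {}" "V \<subseteq> W" for N V
      using W that by blast
  qed
qed

text \<open>The sets are treated one at a time: the witness for \<open>F\<close> is open and
  non-empty inside \<open>U\<close>, so it meets the next set.\<close>

lemma dense_neighbourhoods_finite_Inter:
  assumes "finite F" "openin X U" "U \<noteq> {}"
    and "\<And>y. y \<in> F \<Longrightarrow> openin X (N y)"
    and "\<And>y V. y \<in> F \<Longrightarrow> openin X V \<Longrightarrow> V \<noteq> {} \<Longrightarrow> V \<subseteq> U \<Longrightarrow> V \<inter> N y \<noteq> {}"
  shows "\<exists>V. openin X V \<and> V \<noteq> {} \<and> V \<subseteq> U \<and> (\<forall>y\<in>F. V \<subseteq> N y)"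
  using assms
proof (induction F rule: finite_induct)
  case empty
  then show ?case by blast
next
  case (insert y F)
  have "\<exists>V. openin X V \<and> V \<noteq> {} \<and> V \<subseteq> U \<and> (\<forall>y\<in>F. V \<subseteq> N y)"
    using insert.prems by (intro insert.IH) auto
  then obtain V where V: "openin X V" "V \<noteq> {}" "V \<subseteq> U" "\<forall>y\<in>F. V \<subseteq> N y" by blast
  have "V \<inter> N y \<noteq> {}" "openin X (V \<inter> N y)" using insert.prems V by auto
  then show ?case using V by (intro exI[of _ "V \<inter> N y"]) auto
qed

text \<open>A stage \<open>(F, U)\<close> holds the points chosen so far and the current tail.
  Chosen points are not branching, so their neighbourhoods can be kept dense in the tail, and the
  next tail fits into small neighbourhoods of all of them at once.\<close>

lemma ex_shrinking_tails:
  assumes B: "neighbourhood_bases X B"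
    and E: "\<And>n. openin X (E n)" "\<And>n. dense_in X (E n)" "decseq E" "(\<Inter>n. E n) = {}"
    and M: "openin X M" "M \<noteq> {}" "\<And>x. x \<in> M \<Longrightarrow> \<not> branching X x"
  shows "\<exists>x U. shrinking_tails X x U"
proof -
  note B = neighbourhood_basesD[OF B]
  \<comment> \<open>The last clause, density in the tail of all neighbourhoods of chosen points,
    passes to smaller tails and keeps the recursion going.\<close>
  define P where "P = (\<lambda>n::nat. \<lambda>(F, U). finite F \<and> F \<subseteq> topspace X \<and> openin X U \<and> U \<noteq> {} \<and>
    U \<subseteq> M \<and> U \<subseteq> E n \<and> F \<inter> U = {} \<and>
    (\<forall>y\<in>F. U \<subseteq> B y n) \<and>
    (\<forall>y\<in>F. \<forall>N V. openin X N \<and> y \<in> N \<and> openin X V \<and> V \<noteq> {} \<and> V \<subseteq> U \<longrightarrow> V \<inter> N \<noteq> {}))"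
  define R where "R = (\<lambda>n::nat. \<lambda>(F :: 'a set, U) (F', U' :: 'a set). U' \<subseteq> U \<and> (\<exists>y\<in>U. F' = insert y F))"
  have base: "\<exists>p. P 0 p"
  proof
    have "M \<inter> E 0 \<noteq> {}" by (rule dense_inD[OF E(2) M(1,2)])
    then show "P 0 ({}, M \<inter> E 0)" using M(1) E(1) by (auto simp: P_def)
  qed
  have step: "\<exists>q. P (Suc n) q \<and> R n p q" if Pp: "P n p" for p n
  proof -
    obtain F U where p: "p = (F, U)" by (cases p)
    have FU: "finite F" "openin X U" "U \<noteq> {}" "U \<subseteq> M" "F \<inter> U = {}"
      and sub: "F \<subseteq> topspace X" and
      FU6: "\<And>y N V. y \<in> F \<Longrightarrow> openin X N \<Longrightarrow> y \<in> N \<Longrightarrow> openin X V \<Longrightarrow> V \<noteq> {} \<Longrightarrow> V \<subseteq> U \<Longrightarrow> V \<inter> N \<noteq> {}"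
      using Pp unfolding P_def p by auto
    then obtain y where y: "y \<in> U" by blast
    then have "\<not> branching X y" using M(3) FU(4) by blast
    then obtain W where W: "openin X W" "y \<in> W"
      "\<And>N V. openin X N \<Longrightarrow> y \<in> N \<Longrightarrow> openin X V \<Longrightarrow> V \<noteq> {} \<Longrightarrow> V \<subseteq> W \<Longrightarrow> V \<inter> N \<noteq> {}"
      using not_branchingE by metis
    have dense: "V \<inter> N \<noteq> {}"
      if "z \<in> insert y F" "openin X N" "z \<in> N" "openin X V" "V \<noteq> {}" "V \<subseteq> U \<inter> W" for z N V
      using that FU6[of z N V] W(3)[of N V] by auto
    have "\<exists>V. openin X V \<and> V \<noteq> {} \<and> V \<subseteq> U \<inter> W \<and> (\<forall>z\<in>insert y F. V \<subseteq> B z (Suc n))"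
    proof (rule dense_neighbourhoods_finite_Inter)
      show "finite (insert y F)" using FU(1) by simp
      show "openin X (U \<inter> W)" using FU(2) W(1) by (rule openin_Int)
      show "U \<inter> W \<noteq> {}" using y W(2) by blast
      show "openin X (B z (Suc n))" for z by (rule B(1))
      fix z V assume z: "z \<in> insert y F" and V: "openin X V" "V \<noteq> {}" "V \<subseteq> U \<inter> W"
      have "z \<in> topspace X" using z sub y FU(2) openin_subset by blast
      then show "V \<inter> B z (Suc n) \<noteq> {}" using dense[OF z B(1) _ V] B(2) by blast
    qed
    then obtain V where V: "openin X V" "V \<noteq> {}" "V \<subseteq> U \<inter> W" "\<forall>z\<in>insert y F. V \<subseteq> B z (Suc n)"
      by blast
    obtain k where k: "y \<notin> E k" using E(4) by blast
    \<comment> \<open>\<open>E k\<close> expels \<open>y\<close> from the new tail and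
      \<open>E (Suc n)\<close> is the bound for the next stage; as \<open>E\<close> decreases, the
      larger index serves both.\<close>
    define U' where "U' = V \<inter> E (max k (Suc n))"
    have U'_open: "openin X U'" "U' \<noteq> {}"
      unfolding U'_def using V(1,2) E(1) dense_inD[OF E(2) V(1,2)] by auto
    have U'E: "U' \<subseteq> E k" "U' \<subseteq> E (Suc n)"
      unfolding U'_def using decseqD[OF E(3), of k "max k (Suc n)"]
        decseqD[OF E(3), of "Suc n" "max k (Suc n)"] by auto
    have U'V: "U' \<subseteq> V" unfolding U'_def by blast
    have "P (Suc n) (insert y F, U')"
      unfolding P_def prod.case
    proof (intro conjI ballI allI impI)
      show "finite (insert y F)" "openin X U'" "U' \<noteq> {}" "U' \<subseteq> E (Suc n)"
        using FU(1) U'_open U'E by simp_all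
      show "insert y F \<subseteq> topspace X" using sub y FU(2) openin_subset by blast
      show "U' \<subseteq> M" using U'V V(3) FU(4) by blast
      show "insert y F \<inter> U' = {}" using U'V V(3) FU(5) U'E(1) k by blast
      show "U' \<subseteq> B z (Suc n)" if "z \<in> insert y F" for z using V(4) that U'V by blast
      show "T \<inter> N \<noteq> {}"
        if "z \<in> insert y F" "openin X N \<and> z \<in> N \<and> openin X T \<and> T \<noteq> {} \<and> T \<subseteq> U'" for z N T
        using that U'V V(3) by (intro dense[of z]) auto
    qed
    moreover have "R n p (insert y F, U')" unfolding R_def p using y U'V V(3) by auto
    ultimately show ?thesis by blast
  qed
  have "\<exists>f. \<forall>n. P n (f n) \<and> R n (f n) (f (Suc n))"
    by (rule dependent_nat_choice[of P R, OF base]) (rule step)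
  then obtain f where f: "\<forall>n. P n (f n) \<and> R n (f n) (f (Suc n))" ..
  define F where "F = (\<lambda>n. fst (f n))"
  define U where "U = (\<lambda>n. snd (f n))"
  have PF: "P n (F n, U n)" and RF: "R n (F n, U n) (F (Suc n), U (Suc n))" for n
    using f by (simp_all add: F_def U_def)
  have "\<exists>y. y \<in> U n \<and> F (Suc n) = insert y (F n)" for n
    using RF[of n] unfolding R_def by auto
  then obtain x where x: "\<And>n. x n \<in> U n" "\<And>n. F (Suc n) = insert (x n) (F n)" by metis
  have U_Suc: "U (Suc n) \<subseteq> U n" for n using RF[of n] unfolding R_def by simp
  have xF: "x i \<in> F m" if "i < m" for i m
    using that by (induction m) (auto simp: x(2) less_Suc_eq)
  have "shrinking_tails X x U"
  proof
    fix n
    show "openin X (U n)" using PF[of n] unfolding P_def by simp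
    show "x n \<in> U n" by (rule x)
    have "F (Suc n) \<inter> U (Suc n) = {}" using PF[of "Suc n"] unfolding P_def by simp
    then show "x n \<notin> U (Suc n)" using xF[of n "Suc n"] by blast
  next
    show "decseq U" using U_Suc by (simp add: decseq_Suc_iff)
    have "U n \<subseteq> E n" for n using PF[of n] unfolding P_def by simp
    then have "(\<Inter>n. U n) \<subseteq> (\<Inter>n. E n)" by (intro INF_mono) blast
    then show "(\<Inter>n. U n) = {}" using E(4) by simp
  next
    fix W n assume W: "openin X W" "x n \<in> W"
    then obtain k where "B (x n) k \<subseteq> W" using B(4) by blast
    \<comment> \<open>\<open>Suc n\<close> is the first stage whose \<open>F\<close> contains
      \<open>x n\<close>, and from index \<open>k\<close> on the basic neighbourhoods lie in
      \<open>W\<close>.\<close>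
    moreover have "B (x n) (max k (Suc n)) \<subseteq> B (x n) k" by (intro B(3)) simp
    moreover have "U (max k (Suc n)) \<subseteq> B (x n) (max k (Suc n))"
    proof -
      have "\<forall>y\<in>F (max k (Suc n)). U (max k (Suc n)) \<subseteq> B y (max k (Suc n))"
        using PF[of "max k (Suc n)"] unfolding P_def prod.case by blast
      moreover have "x n \<in> F (max k (Suc n))" by (rule xF) simp
      ultimately show ?thesis by blast
    qed
    ultimately show "\<exists>m. U m \<subseteq> W" by blast
  qed
  then show ?thesis by blast
qed

section \<open>Tree schemes\<close>

text \<open>Finite sequences are written with the most recent entry at the head, so \<open>n # s\<close> is the \<open>n\<close>-th child
  of \<open>s\<close> and \<open>u @ s\<close> is a descendant of \<open>s\<close>.\<close>

definition tree_topology :: "nat list topology" where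
  "tree_topology = topology (\<lambda>W. \<forall>s\<in>W. \<exists>k. \<forall>n\<ge>k. \<forall>u. u @ n # s \<in> W)"

text \<open>This model space refers to no scheme, so any two schemes have homeomorphic sets of
  points through it.\<close>

lemma openin_tree_topology:
  "openin tree_topology W \<longleftrightarrow> (\<forall>s\<in>W. \<exists>k. \<forall>n\<ge>k. \<forall>u. u @ n # s \<in> W)"
proof -
  have "istopology (\<lambda>W. \<forall>s\<in>W. \<exists>k::nat. \<forall>n\<ge>k. \<forall>u. u @ n # s \<in> W)"
    unfolding istopology_def
  proof (intro conjI allI impI ballI)
    fix S T :: "nat list set" and s
    assume "\<forall>s\<in>S. \<exists>k. \<forall>n\<ge>k. \<forall>u. u @ n # s \<in> S" "\<forall>s\<in>T. \<exists>k. \<forall>n\<ge>k. \<forall>u. u @ n # s \<in> T" "s \<in> S \<inter> T"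
    then obtain j k where "\<forall>n\<ge>j. \<forall>u. u @ n # s \<in> S" "\<forall>n\<ge>k. \<forall>u. u @ n # s \<in> T" by blast
    then show "\<exists>k. \<forall>n\<ge>k. \<forall>u. u @ n # s \<in> S \<inter> T" by (intro exI[of _ "max j k"]) auto
  next
    fix \<K> and s
    assume K: "\<forall>K\<in>\<K>. \<forall>s\<in>K. \<exists>k. \<forall>n\<ge>k. \<forall>u. u @ n # s \<in> K" and "s \<in> \<Union>\<K>"
    then obtain K where "K \<in> \<K>" "s \<in> K" by blast
    then obtain k where "\<forall>n\<ge>k. \<forall>u. u @ n # s \<in> K" using K by blast
    then show "\<exists>k. \<forall>n\<ge>k. \<forall>u. u @ n # s \<in> \<Union>\<K>" using \<open>K \<in> \<K>\<close> by blast
  qed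
  then show ?thesis by (simp add: tree_topology_def topology_inverse')
qed

lemma topspace_tree_topology [simp]: "topspace tree_topology = UNIV"
  using openin_subset[of tree_topology UNIV] by (auto simp: openin_tree_topology)

text \<open>Children converge to the point of their parent, yet each one avoids some neighbourhood
  of it. Together these determine the topology on the points, whatever \<open>X\<close> is.\<close>

locale tree_scheme =
  fixes X :: "'a topology" and U :: "nat list \<Rightarrow> 'a set" and x :: "nat list \<Rightarrow> 'a"
  assumes node_open: "openin X (U s)"
    and point_in_node: "x s \<in> U s"
    and child_subset: "U (n # s) \<subseteq> U s"
    and child_disjoint: "m \<noteq> n \<Longrightarrow> U (m # s) \<inter> U (n # s) = {}"
    and children_small: "openin X W \<Longrightarrow> x s \<in> W \<Longrightarrow> \<exists>k. \<forall>n\<ge>k. U (n # s) \<subseteq> W"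
    and child_separated: "\<exists>N. openin X N \<and> x s \<in> N \<and> N \<inter> U (n # s) = {}"
begin

lemma descendant_subset: "U (u @ s) \<subseteq> U s"
  by (induction u) (use child_subset in auto)

lemma point_notin_child: "x s \<notin> U (n # s)"
  using child_separated by blast

text \<open>By induction a point in a child of \<open>s\<close> belongs to a proper descendant of
  \<open>s\<close>, since \<open>x s\<close> lies in no child; disjointness of siblings then
  identifies the child.\<close>

lemma point_in_node_iff: "x t \<in> U s \<longleftrightarrow> (\<exists>u. t = u @ s)"
proof
  show "\<exists>u. t = u @ s \<Longrightarrow> x t \<in> U s"
    using descendant_subset point_in_node by blast
  show "x t \<in> U s \<Longrightarrow> \<exists>u. t = u @ s"
  proof (induction s)
    case (Cons n s)
    then have "x t \<in> U s" using child_subset by blast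
    then obtain u where u: "t = u @ s" using Cons.IH by blast
    have "u \<noteq> []" using Cons.prems point_notin_child u by auto
    \<comment> \<open>Lists grow at the head, so the last entry of \<open>u\<close> names the child
      of \<open>s\<close> through which \<open>t\<close> descends.\<close>
    then obtain v m where v: "u = v @ [m]" by (metis rev_exhaust)
    have "x t \<in> U (m # s)"
      using descendant_subset[of v "m # s"] point_in_node[of t] unfolding u v by auto
    then have "m = n" using Cons.prems child_disjoint by blast
    then show ?case unfolding u v by simp
  qed simp
qed

lemma inj_x: "inj x"
proof (rule injI)
  fix s t assume eq: "x s = x t"
  have "x s \<in> U t" "x t \<in> U s" using point_in_node[of s] point_in_node[of t] eq by simp_all
  then obtain u v where "s = u @ t" "t = v @ s" unfolding point_in_node_iff by blast
  then show "s = t" by (metis append_assoc append_is_Nil_conv append_self_conv2)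
qed

lemma range_subset: "range x \<subseteq> topspace X"
  using point_in_node node_open openin_subset by blast

lemma homeomorphic_tree_topology: "subtopology X (range x) homeomorphic_space tree_topology"
proof (rule homeomorphic_space_subtopology_range[OF inj_x range_subset topspace_tree_topology])
  fix W
  show "openin (subtopology X (range x)) (x ` W) \<longleftrightarrow> openin tree_topology W"
  proof
    assume "openin (subtopology X (range x)) (x ` W)"
    then obtain V where V: "openin X V" "x ` W = V \<inter> range x" by (auto simp: openin_subtopology)
    show "openin tree_topology W"
      unfolding openin_tree_topology
    proof
      fix s assume "s \<in> W"
      then have "x s \<in> V" using V(2) by blast
      then obtain k where k: "\<forall>n\<ge>k. U (n # s) \<subseteq> V" using children_small V(1) by blast
      have "u @ n # s \<in> W" if "n \<ge> k" for n u
      proof -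
        have "x (u @ n # s) \<in> U (n # s)" unfolding point_in_node_iff by blast
        then have "x (u @ n # s) \<in> x ` W" using k that V(2) by blast
        then show ?thesis using inj_x by (simp add: inj_image_mem_iff)
      qed
      then show "\<exists>k. \<forall>n\<ge>k. \<forall>u. u @ n # s \<in> W" by blast
    qed
  next
    assume W: "openin tree_topology W"
    have "\<exists>G. openin X G \<and> x s \<in> G \<and> G \<inter> range x \<subseteq> x ` W" if s: "s \<in> W" for s
    proof -
      obtain k where k: "\<forall>n\<ge>k. \<forall>u. u @ n # s \<in> W"
        using W s unfolding openin_tree_topology by blast
      have "\<forall>n. \<exists>N. openin X N \<and> x s \<in> N \<and> N \<inter> U (n # s) = {}" using child_separated by simp
      from choice[OF this] obtain N
        where N: "\<forall>n. openin X (N n) \<and> x s \<in> N n \<and> N n \<inter> U (n # s) = {}" ..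
      \<comment> \<open>\<open>U s\<close> confines the points to descendants of \<open>s\<close>,
        and the finitely many \<open>N n\<close> discard those below the first \<open>k\<close>
        children.\<close>
      define G where "G = \<Inter>(insert (U s) (N ` {..<k}))"
      have "openin X G" unfolding G_def using N node_open by (intro openin_Inter) auto
      moreover have "x s \<in> G" unfolding G_def using N point_in_node by auto
      moreover have "G \<inter> range x \<subseteq> x ` W"
      proof
        fix y assume y: "y \<in> G \<inter> range x"
        then obtain t where t: "y = x t" by blast
        have "x t \<in> U s" using y t unfolding G_def by blast
        then obtain u where u: "t = u @ s" unfolding point_in_node_iff by blast
        have "t \<in> W"
        proof (cases u rule: rev_cases)
          case Nil
          then show ?thesis using u s by simp
        next
          case (snoc v n)
          then have "x t \<in> U (n # s)" unfolding point_in_node_iff u by simp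
          have "\<not> n < k"
          proof
            assume "n < k"
            moreover have "x t \<in> G" using y t by simp
            ultimately have "x t \<in> N n" unfolding G_def by simp
            then show False using N \<open>x t \<in> U (n # s)\<close> by blast
          qed
          then show ?thesis using k u snoc by simp
        qed
        then show "y \<in> x ` W" using t by blast
      qed
      ultimately show ?thesis by blast
    qed
    then have "\<forall>s\<in>W. \<exists>G. openin X G \<and> x s \<in> G \<and> G \<inter> range x \<subseteq> x ` W" by blast
    from bchoice[OF this] obtain G
      where G: "\<forall>s\<in>W. openin X (G s) \<and> x s \<in> G s \<and> G s \<inter> range x \<subseteq> x ` W" ..
    have "openin X (\<Union>(G ` W))" using G by blast
    moreover have "x ` W = \<Union>(G ` W) \<inter> range x" using G by blast
    ultimately show "openin (subtopology X (range x)) (x ` W)" by (auto simp: openin_subtopology)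
  qed
qed

text \<open>No child of a deepest node around \<open>y\<close> contains \<open>y\<close>, so
  \<open>y\<close> is the point of that node.\<close>

lemma in_range_if_finite_depth:
  assumes "y \<in> U []" "\<And>s. y \<in> U s \<Longrightarrow> length s \<le> d"
    and "\<And>s. y \<in> U s \<Longrightarrow> y = x s \<or> (\<exists>n. y \<in> U (n # s))"
  shows "y \<in> range x"
proof -
  have "\<exists>s. y \<in> U s \<and> (\<forall>t. y \<in> U t \<longrightarrow> length t \<le> length s)"
    by (rule ex_has_greatest_nat[of _ "[]" _ "Suc d"]) (use assms(1,2) in \<open>auto simp: less_Suc_eq_le\<close>)
  then obtain s where s: "y \<in> U s" "\<And>t. y \<in> U t \<Longrightarrow> length t \<le> length s" by blast
  have "y \<notin> U (n # s)" for n using s(2)[of "n # s"] by auto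
  then show ?thesis using assms(3)[OF s(1)] by blast
qed

text \<open>There is one condition for each of the countably many nodes. Points on an infinite
  branch would satisfy them all, and \<open>depth\<close> excludes such points.\<close>

lemma pi02_in_range:
  assumes "second_countable X" "t0_space X"
    and depth: "\<And>y. \<exists>d. \<forall>s. y \<in> U s \<longrightarrow> length s \<le> d"
  shows "pi02_in X (range x)"
proof -
  let ?P = "\<lambda>s. (topspace X - U s) \<union> {x s} \<union> (\<Union>n. U (n # s))"
  have "range x = U [] \<inter> (\<Inter>s. ?P s)"
  proof (intro equalityI subsetI)
    fix y assume "y \<in> range x"
    then obtain t where t: "y = x t" by blast
    have "x t \<in> ?P s" for s
    proof (cases "x t \<in> U s")
      case True
      then obtain u where "t = u @ s" unfolding point_in_node_iff by blast
      then show ?thesis by (cases u rule: rev_cases) (auto simp: point_in_node_iff)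
    qed (use range_subset in auto)
    then show "y \<in> U [] \<inter> (\<Inter>s. ?P s)" unfolding t by (simp add: point_in_node_iff)
  next
    fix y assume y: "y \<in> U [] \<inter> (\<Inter>s. ?P s)"
    obtain d where "\<forall>s. y \<in> U s \<longrightarrow> length s \<le> d" using depth by blast
    then show "y \<in> range x" using y by (intro in_range_if_finite_depth[of y d]) blast+
  qed
  moreover have "pi02_in X (U [] \<inter> (\<Inter>s. ?P s))"
    using assms(1,2) node_open range_subset
    by (intro pi02_in_Int pi02_in_INT pi02_in_open_imp_point_or_open pi02_in_openin openin_Union) auto
  ultimately show ?thesis by (simp only:)
qed

end

section \<open>Construction of tree schemes\<close>

text \<open>These are the axioms of \<open>tree_scheme\<close> at a single node, except openness,
  which the invariant of the recursion carries.\<close>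

definition scheme_step :: "'a topology \<Rightarrow> 'a set \<Rightarrow> 'a \<Rightarrow> (nat \<Rightarrow> 'a set) \<Rightarrow> bool" where
  "scheme_step X V x C \<longleftrightarrow> x \<in> V \<and> (\<forall>n. C n \<subseteq> V) \<and> (\<forall>m n. m \<noteq> n \<longrightarrow> C m \<inter> C n = {}) \<and>
     (\<forall>W. openin X W \<and> x \<in> W \<longrightarrow> (\<exists>k. \<forall>n\<ge>k. C n \<subseteq> W)) \<and>
     (\<forall>n. \<exists>N. openin X N \<and> x \<in> N \<and> N \<inter> C n = {})"

lemma scheme_stepD:
  assumes "scheme_step X V x C"
  shows "x \<in> V" "C n \<subseteq> V" "m \<noteq> n \<Longrightarrow> C m \<inter> C n = {}"
    "openin X W \<Longrightarrow> x \<in> W \<Longrightarrow> \<exists>k. \<forall>n\<ge>k. C n \<subseteq> W"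
    "\<exists>N. openin X N \<and> x \<in> N \<and> N \<inter> C n = {}"
  using assms unfolding scheme_step_def by simp_all

text \<open>\<open>P\<close> is an invariant indexed by depth, and \<open>S\<close> records any
  further relation between a node, its point and its children. A choice that depends only on depth
  and node is iterated along the list.\<close>

lemma ex_tree_scheme:
  assumes "P 0 V" and P_open: "\<And>k V. P k V \<Longrightarrow> openin X V"
    and step: "\<And>k V. P k V \<Longrightarrow> \<exists>x C. scheme_step X V x C \<and> (\<forall>n. P (Suc k) (C n)) \<and> S V x C"
  shows "\<exists>U x. tree_scheme X U x \<and> U [] = V \<and> (\<forall>s. P (length s) (U s) \<and> S (U s) (x s) (\<lambda>n. U (n # s)))"
proof -
  have "\<forall>kV. \<exists>xC. P (fst kV) (snd kV) \<longrightarrow> scheme_step X (snd kV) (fst xC) (snd xC) \<and>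
      (\<forall>n. P (Suc (fst kV)) (snd xC n)) \<and> S (snd kV) (fst xC) (snd xC)"
    using step by (metis fst_conv snd_conv)
  from choice[OF this] obtain c where c: "\<forall>kV. P (fst kV) (snd kV) \<longrightarrow>
      scheme_step X (snd kV) (fst (c kV)) (snd (c kV)) \<and>
      (\<forall>n. P (Suc (fst kV)) (snd (c kV) n)) \<and> S (snd kV) (fst (c kV)) (snd (c kV))" ..
  define U where "U = rec_list V (\<lambda>n s W. snd (c (length s, W)) n)"
  define x where "x = (\<lambda>s. fst (c (length s, U s)))"
  have U_Nil: "U [] = V" and U_Cons: "U (n # s) = snd (c (length s, U s)) n" for n s
    by (simp_all add: U_def)
  have children: "(\<lambda>n. U (n # s)) = snd (c (length s, U s))" for s
    by (rule ext) (rule U_Cons)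
  have P: "P (length s) (U s)" for s
  proof (induction s)
    case Nil
    then show ?case using assms(1) by (simp add: U_Nil)
  next
    case (Cons n s)
    then show ?case using c[rule_format, of "(length s, U s)"] by (simp add: U_Cons)
  qed
  have *: "scheme_step X (U s) (x s) (\<lambda>n. U (n # s)) \<and> S (U s) (x s) (\<lambda>n. U (n # s))" for s
    unfolding children using c[rule_format, of "(length s, U s)"] P[of s] by (simp add: x_def)
  have "tree_scheme X U x"
  proof
    show "openin X (U s)" for s using P P_open by blast
  next
    fix s
    have s: "scheme_step X (U s) (x s) (\<lambda>n. U (n # s))" using * by blast
    note s = scheme_stepD[OF s]
    show "x s \<in> U s" by (rule s)
    show "U (n # s) \<subseteq> U s" for n by (rule s)
    show "U (m # s) \<inter> U (n # s) = {}" if "m \<noteq> n" for m n using that by (rule s)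
    show "\<exists>k. \<forall>n\<ge>k. U (n # s) \<subseteq> W" if "openin X W" "x s \<in> W" for W using that by (rule s)
    show "\<exists>N. openin X N \<and> x s \<in> N \<and> N \<inter> U (n # s) = {}" for n by (rule s)
  qed
  then show ?thesis using U_Nil P * by (intro exI[of _ U] exI[of _ x]) simp
qed

text \<open>With each \<open>C n\<close> comes a neighbourhood \<open>N n\<close> of
  \<open>x\<close> disjoint from it, and all later choices stay inside \<open>N n\<close>. This
  yields disjointness and separation, while \<open>B x n\<close> yields convergence.\<close>

lemma branching_scheme_step:
  assumes B: "neighbourhood_bases X B" and x: "branching X x" "x \<in> V" "openin X V"
    and G: "openin X G" "dense_in X G"
  shows "\<exists>C. scheme_step X V x C \<and> (\<forall>n. openin X (C n) \<and> C n \<noteq> {} \<and> C n \<subseteq> V \<inter> G)"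
proof -
  note B = neighbourhood_basesD[OF B]
  define P where "P = (\<lambda>n. \<lambda>(N, C). openin X N \<and> x \<in> N \<and> openin X C \<and> C \<noteq> {} \<and> C \<subseteq> V \<inter> G \<and>
    C \<subseteq> B x n \<and> N \<inter> C = {})"
  define R where "R = (\<lambda>n::nat. \<lambda>(N :: 'a set, C :: 'a set) (N' :: 'a set, C' :: 'a set). N' \<subseteq> N \<and> C' \<subseteq> N)"
  have ex: "\<exists>N' C'. P n (N', C') \<and> N' \<subseteq> N \<and> C' \<subseteq> N" if N: "openin X N" "x \<in> N" for n N
  proof -
    have "x \<in> topspace X" using x(2,3) openin_subset by blast
    then have W: "openin X (N \<inter> V \<inter> B x n) \<and> x \<in> N \<inter> V \<inter> B x n" using N x B(1,2) by auto
    obtain M C where MC: "openin X M" "x \<in> M" "openin X C" "C \<noteq> {}" "C \<subseteq> N \<inter> V \<inter> B x n" "C \<inter> M = {}"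
      using x(1) W unfolding branching_def by meson
    have "C \<inter> G \<noteq> {}" by (rule dense_inD[OF G(2) MC(3,4)])
    moreover have "openin X (C \<inter> G)" "openin X (M \<inter> N)" using MC G N by auto
    ultimately have "P n (M \<inter> N, C \<inter> G)" unfolding P_def prod.case using MC N by auto
    moreover have "M \<inter> N \<subseteq> N" "C \<inter> G \<subseteq> N" using MC by auto
    ultimately show ?thesis by blast
  qed
  have base: "\<exists>p. P 0 p" using ex[of "topspace X" 0] x(2,3) openin_subset by blast
  have step: "\<exists>q. P (Suc n) q \<and> R n p q" if "P n p" for p n
  proof -
    obtain N C where p: "p = (N, C)" by (cases p)
    have "openin X N" "x \<in> N" using that unfolding P_def p by auto
    then obtain N' C' where "P (Suc n) (N', C')" "N' \<subseteq> N" "C' \<subseteq> N" using ex by blast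
    then show ?thesis unfolding R_def p by (intro exI[of _ "(N', C')"]) simp
  qed
  have "\<exists>f. \<forall>n. P n (f n) \<and> R n (f n) (f (Suc n))"
    by (rule dependent_nat_choice[of P R, OF base]) (rule step)
  then obtain f where f: "\<forall>n. P n (f n) \<and> R n (f n) (f (Suc n))" ..
  define N where "N = (\<lambda>n. fst (f n))"
  define C where "C = (\<lambda>n. snd (f n))"
  have "P n (N n, C n)" for n using f by (simp add: N_def C_def)
  then have NC: "openin X (N n)" "x \<in> N n" "openin X (C n)" "C n \<noteq> {}" "C n \<subseteq> V \<inter> G"
    "C n \<subseteq> B x n" "N n \<inter> C n = {}" for n
    unfolding P_def prod.case by blast+
  have "R n (N n, C n) (N (Suc n), C (Suc n))" for n using f by (simp add: N_def C_def)
  then have Suc: "N (Suc n) \<subseteq> N n" "C (Suc n) \<subseteq> N n" for n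
    unfolding R_def prod.case by blast+
  then have N_mono: "N n \<subseteq> N m" if "m \<le> n" for m n
    using decseqD[of N m n] that Suc(1) by (simp add: decseq_Suc_iff)
  have disj: "C m \<inter> C n = {}" if mn: "m < n" for m n
  proof -
    obtain k where k: "n = Suc k" "m \<le> k" using mn by (metis less_imp_Suc_add le_add1)
    then have "C n \<subseteq> N m" using Suc(2)[of k] N_mono[of m k] by blast
    then show ?thesis using NC(7)[of m] by blast
  qed
  have "scheme_step X V x C"
    unfolding scheme_step_def
  proof (intro conjI allI impI)
    show "x \<in> V" by (rule x(2))
    show "C n \<subseteq> V" for n using NC(5) by blast
    show "C m \<inter> C n = {}" if "m \<noteq> n" for m n
      using disj[of m n] disj[of n m] that by (cases m n rule: linorder_cases) auto
    show "\<exists>N. openin X N \<and> x \<in> N \<and> N \<inter> C n = {}" for n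
      using NC(1,2,7)[of n] by (intro exI[of _ "N n"] conjI)
    fix W assume "openin X W \<and> x \<in> W"
    then obtain k where k: "B x k \<subseteq> W" using B(4) by blast
    have "C n \<subseteq> W" if "k \<le> n" for n using NC(6)[of n] B(3)[OF that, of x] k by blast
    then show "\<exists>k. \<forall>n\<ge>k. C n \<subseteq> W" by blast
  qed
  then show ?thesis using NC(3,4,5) by blast
qed

text \<open>Each node is open, non-empty and inside \<open>M\<close>, so it contains a branching
  point, whose children can be taken inside the next \<open>E\<close>.\<close>

lemma ex_branching_tree_scheme:
  assumes B: "neighbourhood_bases X B"
    and E: "\<And>n. openin X (E n)" "\<And>n. dense_in X (E n)"
    and M: "openin X M" "M \<noteq> {}" "\<And>V. openin X V \<Longrightarrow> V \<noteq> {} \<Longrightarrow> V \<subseteq> M \<Longrightarrow> \<exists>x\<in>V. branching X x"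
  shows "\<exists>U x. tree_scheme X U x \<and> (\<forall>s. U s \<subseteq> E (length s))"
proof -
  define P where "P = (\<lambda>k V. openin X V \<and> V \<noteq> {} \<and> V \<subseteq> M \<and> V \<subseteq> E k)"
  have "P 0 (M \<inter> E 0)" unfolding P_def using dense_inD[OF E(2) M(1,2)] E(1) M(1) by auto
  moreover have "P k V \<Longrightarrow> openin X V" for k V by (simp add: P_def)
  moreover have "\<exists>x C. scheme_step X V x C \<and> (\<forall>n. P (Suc k) (C n)) \<and> True" if PV: "P k V" for k V
  proof -
    obtain x where x: "x \<in> V" "branching X x" using M(3) PV unfolding P_def by blast
    have "openin X V" using PV unfolding P_def by blast
    then obtain C where C: "scheme_step X V x C"
      "\<forall>n. openin X (C n) \<and> C n \<noteq> {} \<and> C n \<subseteq> V \<inter> E (Suc k)"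
      using branching_scheme_step[OF B x(2,1) _ E(1,2)] by blast
    have "P (Suc k) (C n)" for n
    proof -
      have "openin X (C n) \<and> C n \<noteq> {} \<and> C n \<subseteq> V \<inter> E (Suc k)" using C(2) ..
      then show ?thesis using PV unfolding P_def by blast
    qed
    then show ?thesis using C(1) by blast
  qed
  ultimately have "\<exists>U x. tree_scheme X U x \<and> U [] = M \<inter> E 0 \<and> (\<forall>s. P (length s) (U s) \<and> True)"
    by (rule ex_tree_scheme[where S = "\<lambda>_ _ _. True"])
  then obtain U x where "tree_scheme X U x" "\<forall>s. P (length s) (U s)" by blast
  then show ?thesis unfolding P_def by blast
qed

section \<open>The rationals as a tree scheme\<close>

text \<open>\<open>V\<close> without \<open>q\<close> is cut into rings around \<open>q\<close> with
  radii \<open>c / m\<close> for an irrational \<open>c\<close>. No rational lies on a boundary, so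
  the rings are disjoint relatively open sets that cover everything but \<open>q\<close>.\<close>

lemma Rats_scheme_step:
  assumes V: "openin S\<^sub>2 V" "q \<in> V"
  shows "\<exists>C. scheme_step S\<^sub>2 V q C \<and> (\<forall>n. openin S\<^sub>2 (C n) \<and> C n \<noteq> {}) \<and> V \<subseteq> insert q (\<Union>n. C n)"
proof -
  have "\<exists>c\<in>{0<..<1::real}. c \<notin> \<rat>"
    by (intro real_interval_avoid_countable_set countable_rat) simp
  then obtain c :: real where c: "0 < c" "c \<notin> \<rat>" by auto
  obtain T where T: "open T" "V = T \<inter> \<rat>"
    using V(1) unfolding openin_S\<^sub>2 by blast
  have qQ: "q \<in> \<rat>" using V(2) T(2) by blast
  \<comment> \<open>Multiplied out to avoid division: distances from \<open>q\<close> lie between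
    \<open>c / (m + 1)\<close> and \<open>c / m\<close>, without an outer bound for
    \<open>m = 0\<close>.\<close>
  define A where "A = (\<lambda>m::nat. {y \<in> V. real m * \<bar>y - q\<bar> < c \<and> c < real (Suc m) * \<bar>y - q\<bar>})"
  have A_open: "openin S\<^sub>2 (A m)" for m
  proof -
    have "open {y. real m * \<bar>y - q\<bar> < c}" "open {y. c < real (Suc m) * \<bar>y - q\<bar>}"
      by (intro open_Collect_less continuous_intros)+
    then have "open (T \<inter> {y. real m * \<bar>y - q\<bar> < c} \<inter> {y. c < real (Suc m) * \<bar>y - q\<bar>})"
      using T(1) by blast
    moreover have "A m = (T \<inter> {y. real m * \<bar>y - q\<bar> < c} \<inter> {y. c < real (Suc m) * \<bar>y - q\<bar>}) \<inter> \<rat>"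
      unfolding A_def T(2) by blast
    ultimately show ?thesis unfolding openin_S\<^sub>2 by blast
  qed
  have A_disj: "A m \<inter> A n = {}" if "m < n" for m n
  proof -
    have False if "y \<in> A m" "y \<in> A n" for y
    proof -
      have "c < real (Suc m) * \<bar>y - q\<bar>" "real n * \<bar>y - q\<bar> < c" using that by (simp_all add: A_def)
      moreover have "real (Suc m) * \<bar>y - q\<bar> \<le> real n * \<bar>y - q\<bar>"
        using \<open>m < n\<close> by (intro mult_right_mono) auto
      ultimately show False by linarith
    qed
    then show ?thesis by blast
  qed
  have A_cover: "\<exists>m. y \<in> A m" if y: "y \<in> V" "y \<noteq> q" for y
  proof -
    have pos: "\<bar>y - q\<bar> > 0" using y(2) by simp
    then obtain k where "c < real k * \<bar>y - q\<bar>" using reals_Archimedean3 by blast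
    also have "\<dots> \<le> real (Suc k) * \<bar>y - q\<bar>" by (intro mult_right_mono) auto
    finally have k: "c < real (Suc k) * \<bar>y - q\<bar>" .
    define m where "m = (LEAST k. c < real (Suc k) * \<bar>y - q\<bar>)"
    have m: "c < real (Suc m) * \<bar>y - q\<bar>" unfolding m_def by (rule LeastI) (rule k)
    have "real m * \<bar>y - q\<bar> \<le> c"
    proof (cases m)
      case (Suc j)
      then have "\<not> c < real (Suc j) * \<bar>y - q\<bar>"
        using not_less_Least[of j "\<lambda>k. c < real (Suc k) * \<bar>y - q\<bar>"] unfolding m_def by simp
      then show ?thesis using Suc by simp
    qed (use c in simp)
    moreover have "real m * \<bar>y - q\<bar> \<noteq> c"
    proof
      assume eq: "real m * \<bar>y - q\<bar> = c"
      have "y - q \<in> \<rat>" "q - y \<in> \<rat>" using y(1) T(2) qQ by auto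
      then have "real m * \<bar>y - q\<bar> \<in> \<rat>" by (auto simp: abs_if)
      then show False using eq c(2) by simp
    qed
    ultimately have "y \<in> A m" using y(1) m unfolding A_def by simp
    then show ?thesis by blast
  qed
  \<comment> \<open>Children must be non-empty, so only non-empty rings are kept and renumbered;
    infinitely many remain because rationals of \<open>V\<close> accumulate at
    \<open>q\<close>.\<close>
  define I where "I = {m. A m \<noteq> {}}"
  have A_small: "\<bar>y - q\<bar> < d" if "y \<in> A m" "c < real m * d" "0 < d" for y m d
  proof -
    have "real m * \<bar>y - q\<bar> < real m * d" using that by (simp add: A_def)
    then show ?thesis by (simp add: mult_less_cancel_left)
  qed
  have inf: "infinite I"
    unfolding infinite_nat_iff_unbounded_le
  proof
    fix k
    obtain e where e: "e > 0" "ball q e \<subseteq> T" using openE T V(2) by blast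
    \<comment> \<open>\<open>e\<close> keeps the point in \<open>V\<close>, and the other bound
      pushes it into a ring of index at least \<open>k\<close>.\<close>
    define d where "d = min e (c / (real (Suc k)))"
    have "0 < d" using e c by (simp add: d_def)
    then obtain y where y: "y \<in> \<rat>" "q < y" "y < q + d" using Rats_dense_in_real[of q "q + d"] by auto
    then have "y \<in> ball q e" by (simp add: dist_real_def d_def)
    then have "y \<in> V" using e y T by blast
    then obtain m where m: "y \<in> A m" using A_cover y by fastforce
    have "\<bar>y - q\<bar> < c / real (Suc k)" using y by (simp add: d_def)
    then have "real (Suc k) * \<bar>y - q\<bar> < c" by (simp add: field_simps)
    moreover have "c < real (Suc m) * \<bar>y - q\<bar>" using m by (simp add: A_def)
    ultimately have "real (Suc k) * \<bar>y - q\<bar> < real (Suc m) * \<bar>y - q\<bar>" by linarith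
    then have "real (Suc k) < real (Suc m)" by (rule mult_right_less_imp_less) simp
    then have "k \<le> m" by simp
    moreover have "m \<in> I" using m unfolding I_def by blast
    ultimately show "\<exists>n\<ge>k. n \<in> I" by blast
  qed
  define C where "C = (\<lambda>n. A (enumerate I n))"
  have "scheme_step S\<^sub>2 V q C"
    unfolding scheme_step_def
  proof (intro conjI allI impI)
    show "q \<in> V" by (rule V(2))
    show "C n \<subseteq> V" for n unfolding C_def A_def by blast
    show "C m \<inter> C n = {}" if "m \<noteq> n" for m n
    proof -
      have "enumerate I m \<noteq> enumerate I n" using inj_enumerate[OF inf] that by (simp add: inj_eq)
      then show ?thesis unfolding C_def
        using A_disj[of "enumerate I m" "enumerate I n"] A_disj[of "enumerate I n" "enumerate I m"]
        by (cases "enumerate I m" "enumerate I n" rule: linorder_cases) auto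
    qed
    show "\<exists>N. openin S\<^sub>2 N \<and> q \<in> N \<and> N \<inter> C n = {}" for n
    proof -
      let ?m = "enumerate I n"
      let ?N = "{y. real (Suc ?m) * \<bar>y - q\<bar> < c}"
      have "open ?N" by (intro open_Collect_less continuous_intros)
      then have "openin S\<^sub>2 (?N \<inter> \<rat>)" unfolding openin_S\<^sub>2 by blast
      moreover have "q \<in> ?N \<inter> \<rat>" using c qQ by simp
      moreover have "?N \<inter> \<rat> \<inter> C n = {}" unfolding C_def A_def by auto
      ultimately show ?thesis by blast
    qed
    fix W assume "openin S\<^sub>2 W \<and> q \<in> W"
    then obtain G where G: "open G" "W = G \<inter> \<rat>" "q \<in> G"
      unfolding openin_S\<^sub>2 by blast
    then obtain e where e: "e > 0" "ball q e \<subseteq> G" using openE by blast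
    obtain k where k: "c < real k * e" using reals_Archimedean3 e(1) by blast
    have "C n \<subseteq> W" if "k \<le> n" for n
    proof
      fix y assume y: "y \<in> C n"
      have "k \<le> enumerate I n" using le_enumerate[OF inf, of n] that by linarith
      then have "real k * e \<le> real (enumerate I n) * e" using e(1) by (intro mult_right_mono) auto
      then have "c < real (enumerate I n) * e" using k by linarith
      then have "\<bar>y - q\<bar> < e" using A_small[of y "enumerate I n" e] e(1) y unfolding C_def by blast
      then have "y \<in> ball q e" by (simp add: dist_real_def abs_minus_commute)
      moreover have "y \<in> \<rat>" using y T(2) unfolding C_def A_def by blast
      ultimately show "y \<in> W" using e G by blast
    qed
    then show "\<exists>k. \<forall>n\<ge>k. C n \<subseteq> W" by blast
  qed
  moreover have "C n \<noteq> {}" for n using enumerate_in_set[OF inf, of n] unfolding C_def I_def by simp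
  moreover have "V \<subseteq> insert q (\<Union>n. C n)"
  proof
    fix y assume y: "y \<in> V"
    show "y \<in> insert q (\<Union>n. C n)"
    proof (cases "y = q")
      case False
      then obtain m where m: "y \<in> A m" using A_cover y by blast
      then have "m \<in> I" unfolding I_def by blast
      then obtain n where "enumerate I n = m" using enumerate_Ex[OF inf] by blast
      then show ?thesis using m unfolding C_def by blast
    qed simp
  qed
  ultimately show ?thesis using A_open unfolding C_def by blast
qed

text \<open>Every rational is reached since the nodes take the points in the order of an enumeration.\<close>

lemma S\<^sub>2_homeomorphic_tree_topology: "S\<^sub>2 homeomorphic_space tree_topology"
proof -
  define e :: "real \<Rightarrow> nat" where "e = to_nat_on \<rat>"
  have inj: "inj_on e \<rat>" unfolding e_def by (rule inj_on_to_nat_on[OF countable_rat])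
  \<comment> \<open>Nodes at depth \<open>k\<close> hold only rationals numbered at least
    \<open>k\<close>. Taking the least numbered element as the point of a node raises the bound by
    one for its children.\<close>
  define P where "P = (\<lambda>k V. openin S\<^sub>2 V \<and> V \<noteq> {} \<and> (\<forall>q\<in>V. k \<le> e q))"
  have "openin S\<^sub>2 \<rat>" using openin_topspace[of "S\<^sub>2"] by simp
  then have "P 0 \<rat>" unfolding P_def using Rats_0 by blast
  moreover have "P k V \<Longrightarrow> openin S\<^sub>2 V" for k V by (simp add: P_def)
  moreover have "\<exists>q C. scheme_step S\<^sub>2 V q C \<and> (\<forall>n. P (Suc k) (C n)) \<and> V \<subseteq> insert q (\<Union>n. C n)"
    if PV: "P k V" for k V
  proof -
    have V: "openin S\<^sub>2 V" "V \<noteq> {}" "\<forall>q\<in>V. k \<le> e q" using PV unfolding P_def by blast+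
    then have VQ: "V \<subseteq> \<rat>" using openin_subset by fastforce
    obtain q where q: "q \<in> V" "\<And>r. r \<in> V \<Longrightarrow> e q \<le> e r"
      using ex_has_least_nat[of "\<lambda>q. q \<in> V" _ e] V(2) by blast
    obtain C where C: "scheme_step S\<^sub>2 V q C" "\<forall>n. openin S\<^sub>2 (C n) \<and> C n \<noteq> {}" "V \<subseteq> insert q (\<Union>n. C n)"
      using Rats_scheme_step[OF V(1) q(1)] by blast
    note step = scheme_stepD[OF C(1)]
    have "Suc k \<le> e r" if r: "r \<in> C n" for r n
    proof -
      have "r \<in> V" using step(2) r by blast
      have "r \<noteq> q" using step(5)[of n] r by blast
      then have "e r \<noteq> e q" using inj \<open>r \<in> V\<close> q(1) VQ by (meson inj_onD subsetD)
      moreover have "e q \<le> e r" using q(2) \<open>r \<in> V\<close> by blast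
      moreover have "k \<le> e q" using V(3) q(1) by blast
      ultimately show ?thesis by linarith
    qed
    then have "\<forall>n. P (Suc k) (C n)" unfolding P_def using C(2) by blast
    then show ?thesis using C(1,3) by blast
  qed
  ultimately have "\<exists>U x. tree_scheme S\<^sub>2 U x \<and> U [] = \<rat> \<and>
      (\<forall>s. P (length s) (U s) \<and> U s \<subseteq> insert (x s) (\<Union>n. U (n # s)))"
    by (rule ex_tree_scheme[where S = "\<lambda>V q C. V \<subseteq> insert q (\<Union>n. C n)"])
  then obtain U x where Ux: "tree_scheme S\<^sub>2 U x" "U [] = \<rat>"
    "\<forall>s. P (length s) (U s)" "\<forall>s. U s \<subseteq> insert (x s) (\<Union>n. U (n # s))" by blast
  interpret tree_scheme "S\<^sub>2" U x by (rule Ux(1))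
  have "\<rat> \<subseteq> range x"
  proof
    fix y :: real assume y: "y \<in> \<rat>"
    \<comment> \<open>The invariant bounds the depth of the nodes around \<open>y\<close> by the
      number of \<open>y\<close>.\<close>
    have "length s \<le> e y" if "y \<in> U s" for s
      using Ux(3) that unfolding P_def by blast
    moreover have "y = x s \<or> (\<exists>n. y \<in> U (n # s))" if "y \<in> U s" for s
      using Ux(4) that by blast
    ultimately show "y \<in> range x" using y Ux(2) by (intro in_range_if_finite_depth[of y "e y"]) simp_all
  qed
  then have "range x = topspace S\<^sub>2" using range_subset by simp
  then show ?thesis using homeomorphic_tree_topology by (metis subtopology_topspace)
qed

section \<open>From a failure of the Baire property to a test space\<close>

lemma ex_pi02_test_space:
  assumes X: "second_countable X" "t0_space X"
    and E: "\<And>n. openin X (E n)" "\<And>n. dense_in X (E n)" "decseq E" "(\<Inter>n. E n) = {}"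
    and "topspace X \<noteq> {}"
  shows "\<exists>Q. pi02_in X Q \<and> (subtopology X Q homeomorphic_space S\<^sub>D \<or>
    subtopology X Q homeomorphic_space S\<^sub>1 \<or> subtopology X Q homeomorphic_space S\<^sub>2)"
proof -
  obtain B where B: "neighbourhood_bases X B"
    using second_countable_neighbourhood_bases[OF X(1)] .
  show ?thesis
  proof (cases "\<exists>M. openin X M \<and> M \<noteq> {} \<and>
      (\<forall>V. openin X V \<and> V \<noteq> {} \<and> V \<subseteq> M \<longrightarrow> (\<exists>x\<in>V. branching X x))")
    case True
    then obtain M where M: "openin X M" "M \<noteq> {}"
      "\<And>V. openin X V \<Longrightarrow> V \<noteq> {} \<Longrightarrow> V \<subseteq> M \<Longrightarrow> \<exists>x\<in>V. branching X x" by blast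
    have "\<exists>U x. tree_scheme X U x \<and> (\<forall>s. U s \<subseteq> E (length s))"
      using M by (intro ex_branching_tree_scheme[where E = E and M = M, OF B] E(1,2))
    then obtain U x where Ux: "tree_scheme X U x" "\<forall>s. U s \<subseteq> E (length s)" by blast
    interpret tree_scheme X U x by (rule Ux(1))
    \<comment> \<open>Each point lies outside some \<open>E d\<close>, which contains all nodes of
      depth at least \<open>d\<close>.\<close>
    have "\<exists>d. \<forall>s. y \<in> U s \<longrightarrow> length s \<le> d" for y
    proof -
      obtain d where d: "y \<notin> E d" using E(4) by blast
      have "length s \<le> d" if "y \<in> U s" for s
      proof (rule ccontr)
        assume "\<not> length s \<le> d"
        then have "E (length s) \<subseteq> E d" by (intro decseqD[OF E(3)]) simp
        then show False using that Ux(2) d by blast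
      qed
      then show ?thesis by blast
    qed
    then have "pi02_in X (range x)" by (rule pi02_in_range[OF X])
    moreover have "subtopology X (range x) homeomorphic_space S\<^sub>2"
      using homeomorphic_tree_topology S\<^sub>2_homeomorphic_tree_topology
      by (meson homeomorphic_space_sym homeomorphic_space_trans)
    ultimately show ?thesis by blast
  next
    case False
    \<comment> \<open>The negated case, applied to the whole space, yields a non-empty open set
      without branching points.\<close>
    have "openin X (topspace X) \<and> topspace X \<noteq> {}" using assms(7) by simp
    with False have "\<exists>V. openin X V \<and> V \<noteq> {} \<and> V \<subseteq> topspace X \<and> \<not> (\<exists>x\<in>V. branching X x)"
      by meson
    then obtain M where M: "openin X M" "M \<noteq> {}" "\<And>x. x \<in> M \<Longrightarrow> \<not> branching X x" by blast
    have "\<exists>x U. shrinking_tails X x U"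
      using M by (intro ex_shrinking_tails[where E = E and M = M, OF B] E)
    then obtain x U where "shrinking_tails X x U" by blast
    then show ?thesis using shrinking_tails.ex_pi02_S\<^sub>D_or_S\<^sub>1 X by blast
  qed
qed

text \<open>A failure in a closed set \<open>C\<close> is localized to a relatively open
  \<open>G\<close>, on which the dense open sets have empty intersection. \<open>G\<close> is
  locally closed, hence \<Pi>02 in \<open>X\<close>, so a test space that is \<Pi>02 in
  \<open>G\<close> is also \<Pi>02 in \<open>X\<close>.\<close>

lemma completely_Baire_if_no_test_space:
  assumes X: "second_countable X" "t0_space X"
    and no: "\<not> (\<exists>A. pi02_in X A \<and> (subtopology X A homeomorphic_space S\<^sub>D \<or>
      subtopology X A homeomorphic_space S\<^sub>1 \<or> subtopology X A homeomorphic_space S\<^sub>2))"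
  shows "completely_Baire_space X"
  unfolding completely_Baire_space_def
proof (intro allI impI)
  fix C assume C: "closedin X C"
  show "Baire_space (subtopology X C)"
  proof (rule ccontr)
    assume nB: "\<not> Baire_space (subtopology X C)"
    obtain G and D :: "nat \<Rightarrow> 'a set" where G: "openin (subtopology X C) G" "G \<noteq> {}"
      and D: "decseq D" "\<And>n. openin (subtopology X C) (D n)" "\<And>n. dense_in (subtopology X C) (D n)"
        "G \<inter> (\<Inter>n. D n) = {}"
      using not_Baire_spaceE[OF nB] by blast
    obtain T where T: "openin X T" "G = T \<inter> C" using G(1) by (auto simp: openin_subtopology)
    have GC: "G \<subseteq> C" and GX: "G \<subseteq> topspace X" using T C closedin_subset by blast+
    let ?Y = "subtopology X G"
    have Y: "?Y = subtopology (subtopology X C) G"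
      using GC by (simp add: subtopology_subtopology inf.absorb2)
    have open_Y: "openin ?Y W \<longleftrightarrow> openin (subtopology X C) W \<and> W \<subseteq> G" for W
      unfolding Y using G(1) by (rule openin_open_subtopology)
    define E where "E = (\<lambda>n. G \<inter> D n)"
    have E_open: "openin ?Y (E n)" for n
      unfolding open_Y E_def using G(1) D(2) by auto
    have E_dense: "dense_in ?Y (E n)" for n
    proof (rule dense_inI)
      show "E n \<subseteq> topspace ?Y" using E_open openin_subset by blast
      fix W assume "openin ?Y W" "W \<noteq> {}"
      then have W: "openin (subtopology X C) W" "W \<subseteq> G" "W \<noteq> {}" by (auto simp: open_Y)
      have "W \<inter> D n \<noteq> {}" by (rule dense_inD[OF D(3) W(1,3)])
      then show "W \<inter> E n \<noteq> {}" using W(2) unfolding E_def by blast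
    qed
    have "decseq E" using D(1) unfolding E_def decseq_def by blast
    moreover have "(\<Inter>n. E n) = {}" using D(4) unfolding E_def by blast
    moreover have "topspace ?Y \<noteq> {}" using GX G(2) by (simp add: inf.absorb2)
    ultimately have "\<exists>Q. pi02_in ?Y Q \<and> (subtopology ?Y Q homeomorphic_space S\<^sub>D \<or>
        subtopology ?Y Q homeomorphic_space S\<^sub>1 \<or> subtopology ?Y Q homeomorphic_space S\<^sub>2)"
      using E_open E_dense second_countable_subtopology[OF X(1)] t0_space_subtopology[OF X(2)]
      by (intro ex_pi02_test_space[where E = E])
    then obtain Q where Q: "pi02_in ?Y Q" "subtopology ?Y Q homeomorphic_space S\<^sub>D \<or>
      subtopology ?Y Q homeomorphic_space S\<^sub>1 \<or> subtopology ?Y Q homeomorphic_space S\<^sub>2"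
      by blast
    have "pi02_in X G" unfolding T(2) using T(1) C by (intro pi02_in_Int pi02_in_openin pi02_in_closedin)
    then have "pi02_in X Q" using Q(1) by (rule pi02_in_subtopology_trans)
    moreover have "Q \<subseteq> G" using Q(1) by (auto simp: pi02_in_iff)
    then have "subtopology ?Y Q = subtopology X Q" by (simp add: subtopology_subtopology inf.absorb2)
    ultimately show False using no Q(2) by auto
  qed
qed

theorem theorem4p1:
  fixes X :: "'a topology"
  assumes "second_countable X" and "t0_space X"
  shows
    "let P1 = completely_Baire_space X;
         P2 = (\<not> (\<exists>A. A \<noteq> {} \<and> pi02_in X A \<and> countable A \<and>
                   perfect_space (subtopology X A) \<and> TD_space (subtopology X A)));
         P3 = (\<not> (\<exists>A. pi02_in X A \<and>
                   (subtopology X A homeomorphic_space S\<^sub>D \<or>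
                    subtopology X A homeomorphic_space S\<^sub>1 \<or>
                    subtopology X A homeomorphic_space S\<^sub>2)));
         P4 = (\<forall>A. pi02_in X A \<longrightarrow> Baire_space (subtopology X A));
         P5 = (\<forall>A. pi02_in X A \<longrightarrow> completely_Baire_space (subtopology X A))
     in (P1 \<longleftrightarrow> P2) \<and> (P1 \<longleftrightarrow> P3) \<and> (P1 \<longleftrightarrow> P4) \<and> (P1 \<longleftrightarrow> P5)"
proof -
  define P1 P2 P3 P4 P5 where P1: "P1 = completely_Baire_space X"
    and P2: "P2 = (\<not> (\<exists>A. A \<noteq> {} \<and> pi02_in X A \<and> countable A \<and>
      perfect_space (subtopology X A) \<and> TD_space (subtopology X A)))"
    and P3: "P3 = (\<not> (\<exists>A. pi02_in X A \<and> (subtopology X A homeomorphic_space S\<^sub>D \<or>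
      subtopology X A homeomorphic_space S\<^sub>1 \<or> subtopology X A homeomorphic_space S\<^sub>2)))"
    and P4: "P4 = (\<forall>A. pi02_in X A \<longrightarrow> Baire_space (subtopology X A))"
    and P5: "P5 = (\<forall>A. pi02_in X A \<longrightarrow> completely_Baire_space (subtopology X A))"
  have top: "topspace (subtopology X A) = A" if "pi02_in X A" for A
    using that by (auto simp: pi02_in_iff)
  \<comment> \<open>Two cycles are proved: (1), (4), (5), (1) and (1), (4), (2), (3), (1).\<close>
  have "P1 \<Longrightarrow> P4"
    unfolding P1 P4 using completely_Baire_space_pi02 by blast
  moreover have "P4 \<Longrightarrow> P5"
    unfolding P4 P5 completely_Baire_space_def
  proof (intro allI impI)
    fix A C
    assume H: "\<forall>A. pi02_in X A \<longrightarrow> Baire_space (subtopology X A)"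
      and A: "pi02_in X A" and C: "closedin (subtopology X A) C"
    \<comment> \<open>Closed subsets of a \<Pi>02-subspace are again \<Pi>02 in \<open>X\<close>, so
      (4) applies to them directly.\<close>
    have "pi02_in X C" using A pi02_in_closedin[OF C] by (rule pi02_in_subtopology_trans)
    moreover have "C \<subseteq> A" using closedin_subset[OF C] top[OF A] by simp
    then have "subtopology (subtopology X A) C = subtopology X C"
      by (simp add: subtopology_subtopology inf.absorb2)
    ultimately show "Baire_space (subtopology (subtopology X A) C)" using H by simp
  qed
  moreover have "P5 \<Longrightarrow> P1"
    \<comment> \<open>The whole space is one of its own \<Pi>02-subspaces.\<close>
    unfolding P5 P1 using pi02_in_openin[OF openin_topspace, of X] by (metis subtopology_topspace)
  moreover have "P4 \<Longrightarrow> P2"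
  proof -
    assume "P4"
    have False if "A \<noteq> {}" "pi02_in X A" "countable A" "perfect_space (subtopology X A)"
      "TD_space (subtopology X A)" for A
      using countable_perfect_TD_not_Baire[of "subtopology X A"] that top[of A] \<open>P4\<close> unfolding P4 by simp
    then show "P2" unfolding P2 by blast
  qed
  moreover have "P2 \<Longrightarrow> P3"
  proof -
    assume "P2"
    have False if A: "pi02_in X A" and h: "subtopology X A homeomorphic_space S\<^sub>D \<or>
      subtopology X A homeomorphic_space S\<^sub>1 \<or> subtopology X A homeomorphic_space S\<^sub>2" for A
      using homeomorphic_space_test_space[OF h] A \<open>P2\<close> unfolding P2 top[OF A] by blast
    then show "P3" unfolding P3 by blast
  qed
  moreover have "P3 \<Longrightarrow> P1"
    unfolding P3 P1 using completely_Baire_if_no_test_space[OF assms] .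
  ultimately have "(P1 \<longleftrightarrow> P2) \<and> (P1 \<longleftrightarrow> P3) \<and> (P1 \<longleftrightarrow> P4) \<and> (P1 \<longleftrightarrow> P5)" by blast
  then show ?thesis unfolding P1 P2 P3 P4 P5 Let_def .
qed

end
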